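(* Let $p$ be a prime and let $G$ be a pro-$p$ group of finite rank such that, for some $n$, the set $\{g\in G \mid g^{p^n}=1\}$ is a nontrivial subgroup of $G$. If $G$ is self-similar of degree $p$, then $G$ is a finite $p$-group and has exponent at most $p^n$.
   Context: A pro-$p$ group has finite rank if there exists a positive integer $r$ such that every closed subgroup has a topological generating set with no more than $r$ elements. A group $G$ is self-similar of degree $m$ if it has a faithful representation on the infinite regular one-rooted $m$-ary tree that is state-closed and transitive on the first level of the tree. Equivalently, $G$ is self-similar of degree $m$ if there exist a subgroup $H$ of $G$ of index $m$ and a homomorphism $f:H\to G$ such that the only subgroup $K\le H$ that is normal in $G$ and $f$-invariant (i.e. $f(K)\le K$) is the trivial subgroup. *)

theory Defs
  imports
    "HOL-Analysis.Analysis"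
    "HOL-Algebra.Group_Action"
    "HOL-Algebra.Generated_Groups"
    "HOL-Computational_Algebra.Primes"
begin

section \<open>Pro-p groups of finite rank\<close>

text \<open>A topological group is a group together with a topology whose point set is the carrier.\<close>

locale topological_grp = group G for G :: "('a, 'b) monoid_scheme" (structure) +
  fixes T :: "'a topology"
  assumes topspace_eq: "topspace T = carrier G"
    and continuous_mult:
      "continuous_map (prod_topology T T) T (\<lambda>(x, y). x \<otimes> y)"
    and continuous_inv: "continuous_map T T (\<lambda>x. inv x)"

text \<open>
  A profinite group is a compact Hausdorff topological group whose open subgroups form a base of
  neighbourhoods of the identity.  It is pro-p if every open normal subgroup has p-power index.
  (Open subgroups of a compact group have finitely many cosets, so the cardinality below is the
  genuine index; in any case it is nonzero for prime p.)
\<close>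

definition profinite_group :: "('a, 'b) monoid_scheme \<Rightarrow> 'a topology \<Rightarrow> bool" where
  "profinite_group G T \<longleftrightarrow>
     topological_grp G T \<and> compact_space T \<and> Hausdorff_space T \<and>
     (\<forall>U. openin T U \<and> \<one>\<^bsub>G\<^esub> \<in> U \<longrightarrow> (\<exists>H. subgroup H G \<and> openin T H \<and> H \<subseteq> U))"

definition pro_p_group :: "nat \<Rightarrow> ('a, 'b) monoid_scheme \<Rightarrow> 'a topology \<Rightarrow> bool" where
  "pro_p_group p G T \<longleftrightarrow>
     profinite_group G T \<and>
     (\<forall>N. N \<lhd> G \<and> openin T N \<longrightarrow> (\<exists>k::nat. card (rcosets\<^bsub>G\<^esub> N) = p ^ k))"

definition finite_rank :: "('a, 'b) monoid_scheme \<Rightarrow> 'a topology \<Rightarrow> bool" where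
  "finite_rank G T \<longleftrightarrow>
     (\<exists>r::nat. r > 0 \<and>
       (\<forall>H. subgroup H G \<and> closedin T H \<longrightarrow>
         (\<exists>S. S \<subseteq> H \<and> finite S \<and> card S \<le> r \<and> T closure_of (generate G S) = H)))"


section \<open>Self-similar groups\<close>

text \<open>
  The vertices of the regular one-rooted m-ary tree are the finite words over \<open>{0, \<dots>, m - 1}\<close>; the
  root is the empty word and the children of \<open>u\<close> are the words \<open>u @ [x]\<close>.
\<close>

definition tree_vertices :: "nat \<Rightarrow> nat list set" where
  "tree_vertices m = lists {..<m}"

definition child_of :: "nat list \<Rightarrow> nat list \<Rightarrow> bool" where
  "child_of v u \<longleftrightarrow> (\<exists>x. v = u @ [x])"

definition tree_automorphisms :: "nat \<Rightarrow> (nat list \<Rightarrow> nat list) set" where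
  "tree_automorphisms m =
     {f \<in> Bij (tree_vertices m). f [] = [] \<and>
        (\<forall>u \<in> tree_vertices m. \<forall>v \<in> tree_vertices m. child_of (f v) (f u) \<longleftrightarrow> child_of v u)}"

text \<open>
  The state of \<open>f\<close> at \<open>u\<close> is the automorphism induced by \<open>f\<close> from the subtree below \<open>u\<close> to the
  subtree below \<open>f u\<close>, both identified with the whole tree by deleting the prefix.  It is
  characterised by \<open>f (u @ w) = f u @ tree_state m f u w\<close>, see below.
\<close>

definition tree_state ::
    "nat \<Rightarrow> (nat list \<Rightarrow> nat list) \<Rightarrow> nat list \<Rightarrow> nat list \<Rightarrow> nat list" where
  "tree_state m f u = (\<lambda>w \<in> tree_vertices m. drop (length u) (f (u @ w)))"

lemma tree_automorphism_length:
  assumes "f \<in> tree_automorphisms m" "u \<in> tree_vertices m"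
  shows "length (f u) = length u"
  using assms(2)
proof (induction u rule: rev_induct)
  case Nil
  then show ?case using assms(1) by (simp add: tree_automorphisms_def)
next
  case (snoc x u)
  then have "u \<in> tree_vertices m" by (simp add: tree_vertices_def)
  moreover from this have "child_of (f (u @ [x])) (f u)"
    using assms(1) snoc.prems by (simp add: tree_automorphisms_def child_of_def)
  ultimately show ?case using snoc.IH by (auto simp: child_of_def)
qed

lemma tree_state_append:
  assumes f: "f \<in> tree_automorphisms m"
    and u: "u \<in> tree_vertices m" and w: "w \<in> tree_vertices m"
  shows "f (u @ w) = f u @ tree_state m f u w"
proof -
  have "take (length u) (f (u @ w)) = f u"
    using w
  proof (induction w rule: rev_induct)
    case Nil
    then show ?case by (simp add: tree_automorphism_length[OF f u])
  next
    case (snoc x w)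
    then have w: "w \<in> tree_vertices m" by (simp add: tree_vertices_def)
    have uw: "u @ w \<in> tree_vertices m" "(u @ w) @ [x] \<in> tree_vertices m"
      using u snoc.prems by (auto simp: tree_vertices_def)
    then have "child_of (f ((u @ w) @ [x])) (f (u @ w))"
      using f by (simp add: tree_automorphisms_def child_of_def)
    then obtain y where "f (u @ w @ [x]) = f (u @ w) @ [y]"
      by (auto simp: child_of_def)
    then show ?case
      using snoc.IH[OF w] tree_automorphism_length[OF f uw(1)] by simp
  qed
  then show ?thesis
    using w by (metis append_take_drop_id restrict_apply tree_state_def)
qed

text \<open>
  Self-similarity is a property of the abstract group: the representation is not required to be
  continuous.
\<close>

definition self_similar :: "nat \<Rightarrow> ('a, 'b) monoid_scheme \<Rightarrow> bool" where
  "self_similar m G \<longleftrightarrow>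
     (\<exists>\<rho>. faithful_action G (tree_vertices m) \<rho> \<and>
        \<rho> ` carrier G \<subseteq> tree_automorphisms m \<and>
        (\<forall>g \<in> carrier G. \<forall>u \<in> tree_vertices m. tree_state m (\<rho> g) u \<in> \<rho> ` carrier G) \<and>
        (\<forall>x < m. \<forall>y < m. \<exists>g \<in> carrier G. \<rho> g [x] = [y]))"


section \<open>Finite p-groups and the exponent\<close>

definition finite_p_group :: "nat \<Rightarrow> ('a, 'b) monoid_scheme \<Rightarrow> bool" where
  "finite_p_group p G \<longleftrightarrow> group G \<and> finite (carrier G) \<and> (\<exists>k::nat. order G = p ^ k)"

text \<open>Only meaningful for groups of finite exponent, in particular for finite groups.\<close>

definition group_exponent :: "('a, 'b) monoid_scheme \<Rightarrow> nat" where
  "group_exponent G = (LEAST e. e > 0 \<and> (\<forall>g \<in> carrier G. g [^]\<^bsub>G\<^esub> e = \<one>\<^bsub>G\<^esub>))"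

end

theory Submission
  imports
    Defs
    "HOL-Algebra.Multiplicative_Group"
begin

text \<open>
  Let \<open>P\<close> be the subgroup of elements with \<open>g [^] p ^ n = \<one>\<close>.  It is finite: the images of \<open>P\<close>
  in the finite quotients of \<open>G\<close> are p-groups of bounded rank and exponent, and the order of such a
  group is bounded because a maximal abelian normal subgroup \<open>A\<close> is its own centralizer, so that
  a group element is determined up to \<open>A\<close> by its conjugation action on a generating set of \<open>A\<close>
  (\<open>order_le_of_rank_exponent\<close>, \<open>finite_bounded_exponent_subgroup\<close>).

  Self-similarity is used through the stabilizer \<open>H\<close> of the vertex \<open>[0]\<close> and the homomorphism
  \<open>f : H \<rightarrow> G\<close> that sends an element to its state at \<open>[0]\<close>; no nontrivial normal subgroup of \<open>G\<close>
  inside \<open>H\<close> is \<open>f\<close>-invariant.  Every element of \<open>G\<close> has \<open>b\<close>-th roots for all \<open>b\<close> coprime to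
  \<open>p\<close> (\<open>root_exists\<close>), so \<open>G\<close> acts on a finite set only through elements of p-power order, even
  though the action on the tree need not be continuous.  In particular \<open>H\<close> is normal with quotient
  of order \<open>p\<close>, and some \<open>p ^ a\<close>-th power map sends \<open>G\<close> into the centralizer of \<open>P\<close>.

  It remains to see that \<open>G = P\<close> (\<open>carrier_eq_P\<close>).  As \<open>P\<close> is normal and \<open>f\<close> preserves it,
  \<open>P\<close> is not contained in \<open>H\<close>, and so \<open>G = H P\<close>.  Three consequences are combined.

    \<^item> If \<open>f x \<in> P\<close> then \<open>x \<in> P\<close>: modulo \<open>P\<close> the images under \<open>f\<close> of the conjugates of \<open>x\<close> are
      conjugates of \<open>f x\<close>, so they all lie in \<open>P\<close>, and \<open>x [^] p ^ n\<close> has trivial state at all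
      first-level vertices (\<open>f_reflects_P\<close>).
    \<^item> \<open>G\<close> is a torsion group: for \<open>N = p ^ a * p ^ n\<close> the \<open>N\<close>-th powers of elements of \<open>G\<close> are
      the \<open>N\<close>-th powers of elements of \<open>H\<close>, and these generate an \<open>f\<close>-invariant normal subgroup
      (\<open>torsion\<close>).
    \<^item> Let \<open>D i\<close> be the domain of \<open>f ^^ i\<close> (\<open>iterate_dom\<close>).  The chain \<open>P \<inter> D i\<close> becomes stationary, for the
      first time at an index that is written \<open>Suc m\<close>, and \<open>f ^^ m\<close> is trivial on
      \<open>Q = P \<inter> D (Suc m)\<close>: an element of \<open>P \<inter> D m\<close> outside \<open>Q\<close> normalizes \<open>Q\<close>, its image
      under \<open>f ^^ m\<close> lies outside \<open>H\<close> and normalizes the \<open>f\<close>-invariant group \<open>(f ^^ m) ` Q\<close>, and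
      therefore the normal closure of this group in \<open>G\<close> is \<open>f\<close>-invariant
      (\<open>iter_kills_stable_level\<close>).

  If \<open>G \<noteq> P\<close>, torsion gives \<open>x \<notin> P\<close> with \<open>x [^] p \<in> P\<close>.  Multiplying by elements of \<open>P\<close>, which moves
  through all cosets of \<open>H\<close> at each of the first \<open>Suc m\<close> levels, \<open>x\<close> can be taken in
  \<open>D (Suc m)\<close>.  Then \<open>x [^] p ^ n \<in> Q\<close>, so \<open>(f ^^ m) x\<close> is killed by \<open>p ^ n\<close> and lies in
  \<open>P\<close>, although \<open>x\<close> does not.
\<close>

section \<open>Powers, conjugation and centralizers\<close>

lemma (in group) mult_inv_cancel_left:
  assumes "x \<in> carrier G" "y \<in> carrier G"
  shows "x \<otimes> (inv x \<otimes> y) = y" "inv x \<otimes> (x \<otimes> y) = y"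
  using assms by (simp_all add: m_assoc[symmetric])

lemma (in group) conj_nat_pow:
  assumes "g \<in> carrier G" "x \<in> carrier G"
  shows "(g \<otimes> x \<otimes> inv g) [^] (k::nat) = g \<otimes> x [^] k \<otimes> inv g"
  using assms by (induction k) (simp_all add: m_assoc mult_inv_cancel_left)

lemma (in group) subgroup_nat_pow_closed:
  assumes "subgroup K G" "x \<in> K"
  shows "x [^] (k::nat) \<in> K"
  using assms by (induction k) (auto simp: subgroup.one_closed subgroup.m_closed)

lemma (in group) normal_mult_nat_pow:
  assumes N: "N \<lhd> G" and h: "h \<in> carrier G" and u: "u \<in> N"
  shows "\<exists>v\<in>N. (h \<otimes> u) [^] (k::nat) = h [^] k \<otimes> v"
proof (induction k)
  case 0
  show ?case using N by (auto intro: bexI[of _ \<one>] simp: normal_imp_subgroup subgroup.one_closed)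
next
  case (Suc k)
  then obtain v where v: "v \<in> N" "(h \<otimes> u) [^] k = h [^] k \<otimes> v" by blast
  have sub: "subgroup N G" using N by (rule normal_imp_subgroup)
  have [simp]: "u \<in> carrier G" "v \<in> carrier G" using sub u v by (auto dest: subgroup.mem_carrier)
  have "inv h \<otimes> v \<otimes> h \<otimes> u \<in> N"
    using normal.inv_op_closed1[OF N h v(1)] u sub by (auto intro: subgroup.m_closed)
  moreover have "(h \<otimes> u) [^] Suc k = h [^] Suc k \<otimes> (inv h \<otimes> v \<otimes> h \<otimes> u)"
    using v h by (simp add: m_assoc mult_inv_cancel_left)
  ultimately show ?case by blast
qed

definition (in group) centralizer :: "'a set \<Rightarrow> 'a set" where
  "centralizer S = {g \<in> carrier G. \<forall>x\<in>S. g \<otimes> x = x \<otimes> g}"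

context group
begin

lemma centralizer_subgroup:
  assumes S: "S \<subseteq> carrier G"
  shows "subgroup (centralizer S) G"
proof
  show "centralizer S \<subseteq> carrier G" by (auto simp: centralizer_def)
  show "\<one> \<in> centralizer S" using S by (auto simp: centralizer_def subset_iff)
  show "x \<otimes> y \<in> centralizer S" if xy: "x \<in> centralizer S" "y \<in> centralizer S" for x y
  proof -
    have "(x \<otimes> y) \<otimes> s = s \<otimes> (x \<otimes> y)" if s: "s \<in> S" for s
    proof -
      have c: "x \<in> carrier G" "y \<in> carrier G" "s \<in> carrier G" using xy s S by (auto simp: centralizer_def)
      have "(x \<otimes> y) \<otimes> s = x \<otimes> (s \<otimes> y)" using xy s c by (simp add: centralizer_def m_assoc)
      also have "\<dots> = s \<otimes> (x \<otimes> y)" using xy s c by (simp add: centralizer_def flip: m_assoc)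
      finally show ?thesis .
    qed
    then show ?thesis using xy by (simp add: centralizer_def)
  qed
  show "inv x \<in> centralizer S" if x: "x \<in> centralizer S" for x
  proof -
    have "inv x \<otimes> s = s \<otimes> inv x" if s: "s \<in> S" for s
    proof -
      have c: "x \<in> carrier G" "s \<in> carrier G" using x s S by (auto simp: centralizer_def)
      have "inv x \<otimes> (x \<otimes> s) \<otimes> inv x = inv x \<otimes> (s \<otimes> x) \<otimes> inv x"
        using x s by (simp add: centralizer_def)
      then show ?thesis using c by (simp add: m_assoc mult_inv_cancel_left)
    qed
    then show ?thesis using x by (simp add: centralizer_def)
  qed
qed

lemma centralizer_normal:
  assumes N: "N \<lhd> G"
  shows "centralizer N \<lhd> G"
proof -
  have sub: "subgroup N G" using N by (rule normal_imp_subgroup)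
  have "g \<otimes> c \<otimes> inv g \<in> centralizer N" if g: "g \<in> carrier G" and c: "c \<in> centralizer N" for g c
  proof -
    have cc: "c \<in> carrier G" using c by (simp add: centralizer_def)
    have "(g \<otimes> c \<otimes> inv g) \<otimes> x = x \<otimes> (g \<otimes> c \<otimes> inv g)" if x: "x \<in> N" for x
    proof -
      have xc: "x \<in> carrier G" using x sub by (rule subgroup.mem_carrier[rotated])
      let ?y = "inv g \<otimes> x \<otimes> g"
      have "c \<otimes> ?y = ?y \<otimes> c" using c normal.inv_op_closed1[OF N g x] by (simp add: centralizer_def)
      then have "g \<otimes> (c \<otimes> ?y) \<otimes> inv g = g \<otimes> (?y \<otimes> c) \<otimes> inv g" by simp
      then show ?thesis using g cc xc by (simp add: m_assoc mult_inv_cancel_left)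
    qed
    then show ?thesis using g cc by (simp add: centralizer_def)
  qed
  moreover have "subgroup (centralizer N) G" using sub by (intro centralizer_subgroup subgroup.subset)
  ultimately show ?thesis by (simp add: normal_inv_iff)
qed

lemma centralizer_generate:
  assumes S: "S \<subseteq> carrier G"
  shows "centralizer (generate G S) = centralizer S"
proof
  show "centralizer (generate G S) \<subseteq> centralizer S" by (auto simp: centralizer_def generate.incl)
  have "generate G S \<subseteq> centralizer (centralizer S)"
    using S by (intro generate_subgroup_incl centralizer_subgroup) (auto simp: centralizer_def subset_iff)
  then show "centralizer S \<subseteq> centralizer (generate G S)" by (fastforce simp: centralizer_def)
qed

lemma generate_abelian:
  assumes "S \<subseteq> centralizer S"
  shows "generate G S \<subseteq> centralizer (generate G S)"
proof -
  have "S \<subseteq> carrier G" using assms by (auto simp: centralizer_def)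
  then show ?thesis using assms
    by (simp add: centralizer_generate generate_subgroup_incl centralizer_subgroup)
qed

text \<open>
  By commutativity every element of the group generated by \<open>insert a S\<close> is an element of the
  group generated by \<open>S\<close> times \<open>a [^] i\<close> with \<open>i < e\<close>, so each new generator contributes a
  factor of at most \<open>e\<close>.
\<close>
lemma card_abelian_generate_le:
  assumes "finite S" "S \<subseteq> centralizer S" and e: "0 < e" "\<And>x. x \<in> S \<Longrightarrow> x [^] (e::nat) = \<one>"
  shows "finite (generate G S) \<and> card (generate G S) \<le> e ^ card S"
  using assms
proof (induction S rule: finite_induct)
  case empty
  show ?case by (simp add: generate_empty)
next
  case (insert a S)
  let ?K = "generate G S"
  have carr: "insert a S \<subseteq> carrier G" using insert.prems by (auto simp: centralizer_def)
  have K: "subgroup ?K G" using carr by (intro generate_is_subgroup) simp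
  have "S \<subseteq> centralizer S" using insert.prems(1) by (auto simp: centralizer_def)
  then have IH: "finite ?K" "card ?K \<le> e ^ card S" using insert by auto
  have "a \<in> centralizer S" using insert.prems(1) by (auto simp: centralizer_def)
  then have a: "a \<in> centralizer ?K" "a \<in> carrier G" using carr by (auto simp: centralizer_generate)
  have ae: "a [^] e = \<one>" using insert.prems by simp
  have "\<exists>x\<in>?K. \<exists>i::nat. y = x \<otimes> a [^] i" if "y \<in> generate G (insert a S)" for y
    using that
  proof induction
    case one
    show ?case using subgroup.one_closed[OF K] by (intro bexI[of _ \<one>] exI[of _ 0]) auto
  next
    case (incl h)
    show ?case
    proof (cases "h = a")
      case True
      then show ?thesis using subgroup.one_closed[OF K] a by (intro bexI[of _ \<one>] exI[of _ 1]) auto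
    next
      case False
      then show ?thesis using incl carr by (intro bexI[of _ h] exI[of _ 0]) (auto intro: generate.incl)
    qed
  next
    case (inv h)
    show ?case
    proof (cases "h = a")
      case True
      have "a \<otimes> a [^] (e - 1) = \<one>" using ae nat_pow_Suc2[OF a(2), of "e - 1"] e(1) by simp
      then have "inv a = a [^] (e - 1)"
        using a(2) inv_solve_left[of "a [^] (e - 1)" a \<one>] by simp
      then show ?thesis using True subgroup.one_closed[OF K] a
        by (intro bexI[of _ \<one>] exI[of _ "e - 1"]) auto
    next
      case False
      then show ?thesis using inv carr
        by (intro bexI[of _ "inv h"] exI[of _ 0]) (auto intro: generate.inv)
    qed
  next
    case (eng h1 h2)
    then obtain x1 x2 and i1 i2 :: nat where x: "x1 \<in> ?K" "x2 \<in> ?K"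
      and h: "h1 = x1 \<otimes> a [^] i1" "h2 = x2 \<otimes> a [^] i2" by blast
    have c: "x1 \<in> carrier G" "x2 \<in> carrier G" using x K by (auto dest: subgroup.mem_carrier)
    have "a [^] i1 \<in> centralizer ?K"
      using a(1) K by (intro subgroup_nat_pow_closed centralizer_subgroup subgroup.subset)
    then have "a [^] i1 \<otimes> x2 = x2 \<otimes> a [^] i1" using x(2) by (simp add: centralizer_def)
    then have "a [^] i1 \<otimes> (x2 \<otimes> a [^] i2) = x2 \<otimes> (a [^] i1 \<otimes> a [^] i2)"
      using c a(2) by (metis m_assoc nat_pow_closed)
    then have "h1 \<otimes> h2 = (x1 \<otimes> x2) \<otimes> a [^] (i1 + i2)"
      using c a(2) by (simp add: h m_assoc nat_pow_mult)
    then show ?case using x K by (meson subgroup.m_closed)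
  qed
  then have "generate G (insert a S) \<subseteq> (\<lambda>(x, i). x \<otimes> a [^] i) ` (?K \<times> {..<e})"
  proof (intro subsetI)
    fix y assume ex: "\<And>y. y \<in> generate G (insert a S) \<Longrightarrow> \<exists>x\<in>?K. \<exists>i::nat. y = x \<otimes> a [^] i"
    assume "y \<in> generate G (insert a S)"
    then obtain x and i :: nat where x: "x \<in> ?K" "y = x \<otimes> a [^] i" using ex by blast
    have "a [^] i = (a [^] e) [^] (i div e) \<otimes> a [^] (i mod e)"
      using a(2) by (simp add: nat_pow_pow nat_pow_mult)
    then have "y = x \<otimes> a [^] (i mod e)" using x a(2) ae by simp
    then show "y \<in> (\<lambda>(x, i). x \<otimes> a [^] i) ` (?K \<times> {..<e})"
      using x(1) e(1) by (intro image_eqI[of _ _ "(x, i mod e)"]) auto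
  qed
  moreover have "finite (?K \<times> {..<e})" using IH(1) by simp
  ultimately have "finite (generate G (insert a S))"
    and "card (generate G (insert a S)) \<le> card (?K \<times> {..<e})"
    by (auto intro: finite_subset surj_card_le)
  moreover have "card (?K \<times> {..<e}) \<le> e ^ card (insert a S)"
    using IH(2) insert.hyps by (simp add: card_cartesian_product mult.commute)
  ultimately show ?case by simp
qed

end

section \<open>Finite p-groups of bounded rank and exponent\<close>

text \<open>
  Orbits of a p-group have p-power length, so the number of fixed points is congruent modulo \<open>p\<close>
  to the number of points; hence it is not 1.
\<close>
lemma (in group_action) p_group_other_fixed_point:
  assumes p: "Factorial_Ring.prime p" and order: "order G = p ^ k"
    and E: "finite E" "p dvd card E" and x: "x \<in> E" "\<And>g. g \<in> carrier G \<Longrightarrow> \<phi> g x = x"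
  shows "\<exists>y\<in>E. y \<noteq> x \<and> (\<forall>g\<in>carrier G. \<phi> g y = y)"
proof (rule ccontr)
  assume none: "\<not> ?thesis"
  let ?O = "orbits G E \<phi>"
  interpret G: group G using group_hom group_hom.axioms(1) by blast
  have one: "\<phi> \<one> y = y" if "y \<in> E" for y using that id_eq_one by (metis restrict_apply')
  have x_orbit: "orbit G \<phi> x = {x}" using x by (auto simp: orbit_def intro!: exI[of _ \<one>])
  then have x_in: "{x} \<in> ?O" using x(1) by (auto simp: orbits_def)
  have "?O = (orbit G \<phi>) ` E" by (auto simp: orbits_def)
  then have finO: "finite ?O" using E(1) by simp
  have dvd: "p dvd card Y" if "Y \<in> ?O - {{x}}" for Y
  proof -
    obtain y where y: "y \<in> E" "Y = orbit G \<phi> y" using \<open>Y \<in> ?O - {{x}}\<close> by (auto simp: orbits_def)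
    have "y \<noteq> x" using y(2) x_orbit that by auto
    then obtain g where g: "g \<in> carrier G" "\<phi> g y \<noteq> y" using none y(1) by blast
    have "{y, \<phi> g y} \<subseteq> Y" unfolding y(2) orbit_def using g(1) one[OF y(1)] G.one_closed by (metis (mono_tags, lifting) insert_subset empty_subsetI mem_Collect_eq)
    moreover have "Y \<subseteq> E" using y element_image by (auto simp: orbit_def)
    ultimately have "card {y, \<phi> g y} \<le> card Y" using E(1) by (meson card_mono finite_subset)
    then have "card Y \<noteq> 1" using g(2) by simp
    have "card Y dvd p ^ k" using orbit_stabilizer_theorem[OF y(1)] order y(2) by (metis dvd_triv_left)
    then obtain i where "card Y = p ^ i" using p by (auto simp: divides_primepow_nat)
    then show ?thesis using \<open>card Y \<noteq> 1\<close> by (cases i) auto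
  qed
  have "card E = (\<Sum>Y\<in>?O. card Y)" using disjoint_sum[OF E(1), of "\<lambda>_. 1::nat"] by simp
  also have "\<dots> = 1 + (\<Sum>Y\<in>?O - {{x}}. card Y)" using finO x_in by (simp add: sum.remove)
  finally have "p dvd 1 + (\<Sum>Y\<in>?O - {{x}}. card Y)" using E(2) by simp
  moreover have "p dvd (\<Sum>Y\<in>?O - {{x}}. card Y)" using dvd by (rule dvd_sum)
  ultimately have "p dvd 1" by (metis dvd_add_left_iff)
  then show False using p by auto
qed

context group
begin

text \<open>The conjugation action of the group on \<open>N\<close> fixes \<open>\<one>\<close>, hence a second point.\<close>
lemma p_group_normal_meets_center:
  assumes p: "Factorial_Ring.prime p" and order: "order G = p ^ k"
    and N: "N \<lhd> G" "N \<noteq> {\<one>}"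
  shows "\<exists>y\<in>N. y \<noteq> \<one> \<and> (\<forall>g\<in>carrier G. g \<otimes> y = y \<otimes> g)"
proof -
  have fin: "finite (carrier G)" using order p by (metis card.infinite not_prime_0 order_def power_not_zero)
  have sub: "subgroup N G" using N(1) by (rule normal_imp_subgroup)
  have mem: "y \<in> carrier G" if "y \<in> N" for y using sub that by (rule subgroup.mem_carrier)
  let ?c = "\<lambda>g. \<lambda>y\<in>N. g \<otimes> y \<otimes> inv g"
  have bij: "?c g \<in> Bij N" if g: "g \<in> carrier G" for g
  proof -
    have "bij_betw (?c g) N N"
    proof (rule bij_betwI[where g = "?c (inv g)"])
      show "?c g \<in> N \<rightarrow> N" using normal.inv_op_closed2[OF N(1) g] by auto
      show "?c (inv g) \<in> N \<rightarrow> N" using normal.inv_op_closed2[OF N(1) inv_closed[OF g]] by auto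
      show "?c (inv g) (?c g y) = y" if "y \<in> N" for y
        using normal.inv_op_closed2[OF N(1) g that] that mem g
        by (simp add: m_assoc mult_inv_cancel_left)
      show "?c g (?c (inv g) y) = y" if "y \<in> N" for y
        using normal.inv_op_closed1[OF N(1) g that] that mem g
        by (simp add: m_assoc mult_inv_cancel_left)
    qed
    then show ?thesis by (simp add: Bij_def)
  qed
  have "group_action G N ?c"
  proof (intro group_action.intro group_hom.intro group_hom_axioms.intro homI group_BijGroup is_group)
    show "?c g \<in> carrier (BijGroup N)" if "g \<in> carrier G" for g
      using bij[OF that] by (simp add: BijGroup_def)
    show "?c (g \<otimes> h) = ?c g \<otimes>\<^bsub>BijGroup N\<^esub> ?c h" if "g \<in> carrier G" "h \<in> carrier G" for g h
      using that bij normal.inv_op_closed2[OF N(1)] mem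
      by (auto simp: BijGroup_def compose_def m_assoc inv_mult_group fun_eq_iff restrict_def)
  qed
  then interpret c: group_action G N ?c .
  have "card N dvd p ^ k" using lagrange[OF sub] order by (metis dvd_triv_right)
  then obtain i where i: "card N = p ^ i" using p by (auto simp: divides_primepow_nat)
  have "i \<noteq> 0" using i N(2) subgroup.one_closed[OF sub] by (auto simp: card_1_singleton_iff)
  then have "p dvd card N" using i by simp
  moreover have "finite N" using fin sub by (meson finite_subset subgroup.subset)
  ultimately obtain y where y: "y \<in> N" "y \<noteq> \<one>" "\<forall>g\<in>carrier G. ?c g y = y"
    using c.p_group_other_fixed_point[OF p order, of \<one>] subgroup.one_closed[OF sub] by auto
  have "g \<otimes> y = y \<otimes> g" if "g \<in> carrier G" for g
  proof -
    have "g \<otimes> y \<otimes> inv g \<otimes> g = y \<otimes> g" using y that by auto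
    then show ?thesis using that mem[OF y(1)] by (simp add: m_assoc)
  qed
  then show ?thesis using y by blast
qed

text \<open>The image of \<open>C\<close> in the quotient by \<open>A\<close> is a nontrivial normal subgroup and meets the center.\<close>
lemma p_group_central_mod_normal:
  assumes p: "Factorial_Ring.prime p" and order: "order G = p ^ k"
    and A: "A \<lhd> G" and C: "C \<lhd> G" and not_le: "\<not> C \<subseteq> A"
  obtains c where "c \<in> C" "c \<notin> A" "\<And>g. g \<in> carrier G \<Longrightarrow> g \<otimes> c \<otimes> inv g \<otimes> inv c \<in> A"
proof -
  have Asub: "subgroup A G" using A by (rule normal_imp_subgroup)
  have C_carr: "c \<in> carrier G" if "c \<in> C" for c
    using normal_imp_subgroup[OF C] that by (rule subgroup.mem_carrier)
  let ?Q = "G Mod A" and ?\<pi> = "\<lambda>g. A #> g"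
  have Q: "group ?Q" using A by (rule normal.factorgroup_is_group)
  have hom: "group_hom G ?Q ?\<pi>"
    using normal.r_coset_hom_Mod[OF A] Q is_group by (simp add: group_hom_def group_hom_axioms_def)
  have surj: "carrier ?Q = ?\<pi> ` carrier G" by (auto simp: FactGroup_def RCOSETS_def)
  have mult: "?\<pi> x \<otimes>\<^bsub>?Q\<^esub> ?\<pi> y = ?\<pi> (x \<otimes> y)" if "x \<in> carrier G" "y \<in> carrier G" for x y
    using group_hom.hom_mult[OF hom that] by simp
  have ker: "x \<otimes> inv y \<in> A" if "x \<in> carrier G" "y \<in> carrier G" "?\<pi> x = ?\<pi> y" for x y
    using subgroup.rcos_module_imp[OF Asub is_group that(2), of x] rcos_self[OF that(1) Asub] that(3) by simp
  have one: "\<one>\<^bsub>?Q\<^esub> = A" by (simp add: FactGroup_def)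
  have "order ?Q dvd p ^ k"
    using lagrange[OF Asub] order unfolding order_def FactGroup_def by (simp, metis dvd_triv_left)
  then obtain j where j: "order ?Q = p ^ j" using p by (auto simp: divides_primepow_nat)
  have img: "?\<pi> ` C \<lhd> ?Q"
    using normal.surj_hom_normal_subgroup[OF C hom surj[symmetric]] by simp
  obtain c0 where c0: "c0 \<in> C" "c0 \<notin> A" using not_le by blast
  have "?\<pi> c0 \<noteq> A" using c0 rcos_self[OF C_carr[OF c0(1)] Asub] by blast
  then have "?\<pi> ` C \<noteq> {\<one>\<^bsub>?Q\<^esub>}" using c0(1) one by blast
  then obtain Y where Y: "Y \<in> ?\<pi> ` C" "Y \<noteq> \<one>\<^bsub>?Q\<^esub>"
    "\<forall>X\<in>carrier ?Q. X \<otimes>\<^bsub>?Q\<^esub> Y = Y \<otimes>\<^bsub>?Q\<^esub> X"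
    using group.p_group_normal_meets_center[OF Q p j img] by blast
  obtain c where c: "c \<in> C" "Y = ?\<pi> c" using Y(1) by blast
  have cc: "c \<in> carrier G" using c(1) by (rule C_carr)
  show thesis
  proof
    show "c \<in> C" by (rule c(1))
    show "c \<notin> A" using Y(2) c(2) coset_join2[OF cc Asub] one by auto
    show "g \<otimes> c \<otimes> inv g \<otimes> inv c \<in> A" if g: "g \<in> carrier G" for g
    proof -
      have "?\<pi> g \<otimes>\<^bsub>?Q\<^esub> ?\<pi> c = ?\<pi> c \<otimes>\<^bsub>?Q\<^esub> ?\<pi> g" using Y(3) c g surj by blast
      then have "?\<pi> (g \<otimes> c) = ?\<pi> (c \<otimes> g)" using g cc mult by simp
      then have "g \<otimes> c \<otimes> inv (c \<otimes> g) \<in> A" using g cc by (intro ker) auto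
      then show ?thesis using g cc by (simp add: inv_mult_group m_assoc)
    qed
  qed
qed

text \<open>
  \<open>A\<close> is a maximal abelian normal subgroup.  If its centralizer were larger, it would contain an
  element \<open>c \<notin> A\<close> that is central modulo \<open>A\<close>; then \<open>A\<close> and the conjugates of \<open>c\<close>, which all
  lie in \<open>A c\<close>, would generate a larger abelian normal subgroup.
\<close>
lemma p_group_self_centralising_normal:
  assumes p: "Factorial_Ring.prime p" and order: "order G = p ^ k"
  obtains A where "A \<lhd> G" "centralizer A = A"
proof -
  have fin: "finite (carrier G)" using order p by (metis card.infinite not_prime_0 order_def power_not_zero)
  let ?\<A> = "{A. A \<lhd> G \<and> A \<subseteq> centralizer A}"
  have "?\<A> \<subseteq> Pow (carrier G)" by (auto simp: centralizer_def)
  then have "finite ?\<A>" by (rule finite_subset) (simp add: fin)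
  moreover have "{\<one>} \<in> ?\<A>" by (simp add: one_is_normal centralizer_def)
  then have "?\<A> \<noteq> {}" by (metis empty_iff)
  ultimately have "\<exists>A\<in>?\<A>. \<forall>B\<in>?\<A>. A \<subseteq> B \<longrightarrow> A = B" by (rule finite_has_maximal)
  then obtain A where A: "A \<in> ?\<A>" and max: "\<forall>B\<in>?\<A>. A \<subseteq> B \<longrightarrow> A = B" by (rule bexE)
  have An: "A \<lhd> G" and Aab: "A \<subseteq> centralizer A" using A by auto
  have Asub: "subgroup A G" using An by (rule normal_imp_subgroup)
  let ?C = "centralizer A"
  have "?C \<subseteq> A"
  proof (rule ccontr)
    assume "\<not> ?C \<subseteq> A"
    then obtain c where c: "c \<in> ?C" "c \<notin> A"
      and comm: "\<And>g. g \<in> carrier G \<Longrightarrow> g \<otimes> c \<otimes> inv g \<otimes> inv c \<in> A"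
      using p_group_central_mod_normal[OF p order An centralizer_normal[OF An]] by blast
    have cc: "c \<in> carrier G" using c by (simp add: centralizer_def)
    let ?S = "A \<union> {g \<otimes> c \<otimes> inv g | g. g \<in> carrier G}"
    let ?B = "generate G (insert c A)"
    have Acar: "insert c A \<subseteq> carrier G" using cc subgroup.subset[OF Asub] by blast
    have "insert c A \<subseteq> centralizer (insert c A)" 
      using Aab c(1) by (auto simp: centralizer_def)
    then have B_ab: "?B \<subseteq> centralizer ?B" by (rule generate_abelian)
    have Bsub: "subgroup ?B G" using Acar by (rule generate_is_subgroup)
    have "?S \<subseteq> ?B"
    proof (intro subsetI)
      fix s assume "s \<in> ?S"
      then consider "s \<in> A" | g where "g \<in> carrier G" "s = g \<otimes> c \<otimes> inv g" by blast
      then show "s \<in> ?B"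
      proof cases
        case 1
        then show ?thesis by (auto intro: generate.incl)
      next
        case 2
        have "g \<otimes> c \<otimes> inv g \<otimes> inv c \<in> ?B" "c \<in> ?B" using comm[OF 2(1)] by (auto intro: generate.incl)
        then have "(g \<otimes> c \<otimes> inv g \<otimes> inv c) \<otimes> c \<in> ?B" by (rule subgroup.m_closed[OF Bsub])
        moreover have "(g \<otimes> c \<otimes> inv g \<otimes> inv c) \<otimes> c = s" using 2 cc by (simp add: m_assoc)
        ultimately show ?thesis by simp
      qed
    qed
    then have S_ab: "?S \<subseteq> centralizer ?S" using B_ab unfolding centralizer_def by blast
    have "generate G ?S \<lhd> G"
    proof (rule normal_generateI)
      show "?S \<subseteq> carrier G" using S_ab by (auto simp: centralizer_def)
      show "g \<otimes> s \<otimes> inv g \<in> ?S" if "s \<in> ?S" "g \<in> carrier G" for s g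
      proof -
        consider "s \<in> A" | k where "k \<in> carrier G" "s = k \<otimes> c \<otimes> inv k"
          using \<open>s \<in> ?S\<close> by blast
        then show ?thesis
        proof cases
          case 1
          then show ?thesis using normal.inv_op_closed2[OF An \<open>g \<in> carrier G\<close>] by blast
        next
          case 2
          then have "g \<otimes> s \<otimes> inv g = (g \<otimes> k) \<otimes> c \<otimes> inv (g \<otimes> k)"
            using cc \<open>g \<in> carrier G\<close> by (simp add: m_assoc inv_mult_group)
          then show ?thesis using 2(1) \<open>g \<in> carrier G\<close> by blast
        qed
      qed
    qed
    then have "generate G ?S \<in> ?\<A>" using generate_abelian[OF S_ab] by simp
    moreover have "A \<subseteq> generate G ?S" by (auto intro: generate.incl)
    ultimately have "A = generate G ?S" using max by (intro max[rule_format])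
    moreover have "c \<in> ?S" using cc by (auto intro!: exI[of _ \<one>])
    then have "c \<in> generate G ?S" by (rule generate.incl)
    ultimately show False using c(2) \<open>A = generate G ?S\<close> by blast
  qed
  then show ?thesis using that An Aab by blast
qed

text \<open>
  For a self-centralizing normal abelian \<open>A\<close> generated by \<open>S\<close> with \<open>card S \<le> r\<close>, two elements of
  the group that conjugate \<open>S\<close> in the same way differ by an element of \<open>A\<close>.  So the order is at
  most \<open>card A\<close> times the number of functions from \<open>S\<close> to \<open>A\<close>, and \<open>card A \<le> e ^ r\<close>.  The
  bound depends neither on the prime nor on the order, which is what makes it applicable to all
  finite quotients of a pro-p group at once.
\<close>
lemma order_le_of_rank_exponent:
  assumes p: "Factorial_Ring.prime p" and order: "order G = p ^ k"
    and e: "0 < e" "\<And>x. x \<in> carrier G \<Longrightarrow> x [^] (e::nat) = \<one>"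
    and rank: "\<And>K. subgroup K G \<Longrightarrow> \<exists>S. S \<subseteq> K \<and> finite S \<and> card S \<le> r \<and> generate G S = K"
  shows "order G \<le> e ^ r * (e ^ r) ^ r"
proof -
  obtain A where A: "A \<lhd> G" "centralizer A = A"
    using p_group_self_centralising_normal[OF p order] .
  have Asub: "subgroup A G" using A(1) by (rule normal_imp_subgroup)
  then obtain S where S: "S \<subseteq> A" "finite S" "card S \<le> r" "generate G S = A" using rank by blast
  have S_carr: "S \<subseteq> carrier G" using S(1) subgroup.subset[OF Asub] by blast
  have comm_S: "centralizer S = A" using centralizer_generate[OF S_carr] A(2) S(4) by simp
  have "finite A" "card A \<le> e ^ card S"
    using card_abelian_generate_le[OF S(2) _ e(1)] S(1,4) comm_S S_carr e(2) by auto
  moreover have "e ^ card S \<le> e ^ r" using e(1) S(3) by (intro power_increasing) auto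
  ultimately have A_card: "finite A" "card A \<le> e ^ r" by auto
  let ?\<Phi> = "\<lambda>g. \<lambda>s\<in>S. g \<otimes> s \<otimes> inv g"
  let ?F = "S \<rightarrow>\<^sub>E A"
  let ?fib = "\<lambda>\<psi>. {g \<in> carrier G. ?\<Phi> g = \<psi>}"
  have fib: "finite (?fib \<psi>) \<and> card (?fib \<psi>) \<le> card A" for \<psi>
  proof (cases "?fib \<psi> = {}")
    case True
    then show ?thesis by (metis card.empty finite.emptyI le0)
  next
    case False
    then obtain h where h: "h \<in> carrier G" "?\<Phi> h = \<psi>" by blast
    have "?fib \<psi> \<subseteq> (\<lambda>a. h \<otimes> a) ` A"
    proof
      fix g assume "g \<in> ?fib \<psi>"
      then have g: "g \<in> carrier G" "?\<Phi> g = ?\<Phi> h" using h by auto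
      have "inv h \<otimes> g \<in> centralizer S"
      proof -
        have "(inv h \<otimes> g) \<otimes> s = s \<otimes> (inv h \<otimes> g)" if s: "s \<in> S" for s
        proof -
          have sc: "s \<in> carrier G" using s S_carr by blast
          have "g \<otimes> s \<otimes> inv g = h \<otimes> s \<otimes> inv h" using fun_cong[OF g(2), of s] s by simp
          then have "inv h \<otimes> (g \<otimes> s \<otimes> inv g) \<otimes> g = inv h \<otimes> (h \<otimes> s \<otimes> inv h) \<otimes> g" by simp
          then show ?thesis using sc g(1) h(1) by (simp add: m_assoc mult_inv_cancel_left)
        qed
        then show ?thesis using g(1) h(1) by (simp add: centralizer_def)
      qed
      then have "inv h \<otimes> g \<in> A" using comm_S by simp
      moreover have "g = h \<otimes> (inv h \<otimes> g)" using g(1) h(1) by (simp add: mult_inv_cancel_left)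
      ultimately show "g \<in> (\<lambda>a. h \<otimes> a) ` A" by blast
    qed
    then show ?thesis using A_card(1) by (meson finite_imageI finite_subset surj_card_le)
  qed
  have F: "finite ?F" "card ?F \<le> (e ^ r) ^ r"
  proof -
    show "finite ?F" using S(2) A_card(1) by (intro finite_PiE)
    have "card ?F = card A ^ card S" using S(2) by (simp add: card_PiE)
    also have "\<dots> \<le> (e ^ r) ^ card S" using A_card(2) by (rule power_mono) simp
    also have "\<dots> \<le> (e ^ r) ^ r" using e(1) S(3) by (intro power_increasing) auto
    finally show "card ?F \<le> (e ^ r) ^ r" .
  qed
  have "carrier G = (\<Union>\<psi>\<in>?F. ?fib \<psi>)"
    using normal.inv_op_closed2[OF A(1)] S(1) by fastforce
  then have "order G \<le> (\<Sum>\<psi>\<in>?F. card (?fib \<psi>))" 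
    unfolding order_def using card_UN_le[OF F(1), of ?fib] by simp
  also have "\<dots> \<le> card ?F * card A" using sum_bounded_above[of ?F "\<lambda>\<psi>. card (?fib \<psi>)" "card A"] fib by simp
  also have "\<dots> \<le> (e ^ r) ^ r * e ^ r" using F(2) A_card(2) by (rule mult_le_mono)
  finally show ?thesis by (simp add: mult.commute)
qed

end

section \<open>Roots and torsion in pro-p groups\<close>

locale pro_p = topological_grp +
  fixes p :: nat
  assumes prime_p: "Factorial_Ring.prime p"
    and compact: "compact_space T" and Hausdorff: "Hausdorff_space T"
    and base: "\<lbrakk>openin T U; \<one> \<in> U\<rbrakk> \<Longrightarrow> \<exists>V. subgroup V G \<and> openin T V \<and> V \<subseteq> U"
    and index: "\<lbrakk>N \<lhd> G; openin T N\<rbrakk> \<Longrightarrow> \<exists>k::nat. card (rcosets N) = p ^ k"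
begin

lemma continuous_map_mult:
  assumes "continuous_map T T u" "continuous_map T T v"
  shows "continuous_map T T (\<lambda>x. u x \<otimes> v x)"
proof -
  have "continuous_map T (prod_topology T T) (\<lambda>x. (u x, v x))"
    using assms by (simp add: continuous_map_pairedI)
  from continuous_map_compose[OF this continuous_mult] show ?thesis by (simp add: o_def)
qed

lemma continuous_map_constant: "a \<in> carrier G \<Longrightarrow> continuous_map T T (\<lambda>x. a)"
  by (simp add: topspace_eq)

lemma continuous_map_nat_pow: "continuous_map T T (\<lambda>x. x [^] (k::nat))"
proof (induction k)
  case 0
  show ?case using continuous_map_constant[OF one_closed] by simp
next
  case (Suc k)
  then show ?case
    using continuous_map_mult[OF Suc continuous_map_id[unfolded id_def]] by simp
qed

lemma openin_translated_vimage:
  assumes V: "openin T V" and a: "a \<in> carrier G" "b \<in> carrier G"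
  shows "openin T {x \<in> carrier G. a \<otimes> x \<otimes> b \<in> V}"
proof -
  have "continuous_map T T (\<lambda>x. a \<otimes> x \<otimes> b)"
    using a by (intro continuous_map_mult continuous_map_constant continuous_map_id[unfolded id_def])
  from openin_continuous_map_preimage[OF this V] show ?thesis by (simp add: topspace_eq)
qed

lemma openin_r_coset:
  assumes V: "subgroup V G" "openin T V" and g: "g \<in> carrier G"
  shows "openin T (V #> g)"
proof -
  have "V #> g = {x \<in> carrier G. \<one> \<otimes> x \<otimes> inv g \<in> V}"
    using subgroup.rcos_module[OF V(1) is_group g] r_coset_subset_G[OF subgroup.subset[OF V(1)] g] by auto
  then show ?thesis using openin_translated_vimage[OF V(2)] g by simp
qed

text \<open>
  An open subgroup \<open>V\<close> has finitely many cosets by compactness, and so only finitely many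
  conjugates.  Their intersection is open and normal.
\<close>
lemma open_normal_base:
  assumes U: "openin T U" "\<one> \<in> U"
  obtains N where "N \<lhd> G" "openin T N" "N \<subseteq> U"
proof -
  obtain V where V: "subgroup V G" "openin T V" "V \<subseteq> U" using base[OF U] by blast
  have "carrier G \<subseteq> (\<Union>g\<in>carrier G. V #> g)" using rcos_self[OF _ V(1)] by blast
  moreover have "openin T X" if "X \<in> (\<lambda>g. V #> g) ` carrier G" for X
    using that openin_r_coset[OF V(1,2)] by blast
  moreover have "compactin T (carrier G)" using compact by (simp add: compact_space_def topspace_eq)
  ultimately have "\<exists>\<F>. finite \<F> \<and> \<F> \<subseteq> (\<lambda>g. V #> g) ` carrier G \<and> carrier G \<subseteq> \<Union>\<F>"
    by (intro compactinD)
  then obtain \<F> where \<F>: "finite \<F>" "\<F> \<subseteq> (\<lambda>g. V #> g) ` carrier G" "carrier G \<subseteq> \<Union>\<F>"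
    by (elim exE conjE)
  obtain F where "F \<subseteq> carrier G" "finite F" "\<F> = (\<lambda>g. V #> g) ` F"
    using finite_subset_image[OF \<F>(1,2)] by (elim exE conjE)
  then have F: "finite F" "F \<subseteq> carrier G" "carrier G \<subseteq> (\<Union>g\<in>F. V #> g)"
    using \<F>(3) by simp_all
  define N where "N = {x \<in> carrier G. \<forall>g\<in>carrier G. g \<otimes> x \<otimes> inv g \<in> V}"
  have "x \<in> N" if x: "x \<in> carrier G" "\<And>g. g \<in> F \<Longrightarrow> g \<otimes> x \<otimes> inv g \<in> V" for x
  proof -
    have "g \<otimes> x \<otimes> inv g \<in> V" if "g \<in> carrier G" for g
    proof -
      obtain h v where h: "h \<in> F" "v \<in> V" "g = v \<otimes> h"
        using F(3) \<open>g \<in> carrier G\<close> unfolding r_coset_def by blast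
      have c: "v \<in> carrier G" "h \<in> carrier G" using h F(2) V(1) by (auto dest: subgroup.mem_carrier)
      have "v \<otimes> (h \<otimes> x \<otimes> inv h) \<otimes> inv v \<in> V"
        using x(2)[OF h(1)] h(2) V(1) by (simp add: subgroup.m_closed subgroup.m_inv_closed)
      then show ?thesis using h(3) c x(1) by (simp add: m_assoc inv_mult_group)
    qed
    then show ?thesis using x(1) by (simp add: N_def)
  qed
  then have "N = carrier G \<inter> (\<Inter>g\<in>F. {x \<in> carrier G. g \<otimes> x \<otimes> inv g \<in> V})"
    using F(2) by (auto simp: N_def)
  moreover have "openin T (carrier G \<inter> (\<Inter>g\<in>F. {x \<in> carrier G. g \<otimes> x \<otimes> inv g \<in> V}))"
  proof (cases "F = {}")
    case True
    then show ?thesis using openin_topspace[of T] topspace_eq by simp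
  next
    case False
    then show ?thesis using F(1,2) V(2) openin_topspace[of T] topspace_eq
      by (intro openin_Int openin_INT2 openin_translated_vimage) auto
  qed
  ultimately have "openin T N" by simp
  moreover have "N \<lhd> G"
  proof -
    have "subgroup N G"
    proof
      show "N \<subseteq> carrier G" by (auto simp: N_def)
      show "\<one> \<in> N" using V(1) by (simp add: N_def subgroup.one_closed)
      show "x \<otimes> y \<in> N" if "x \<in> N" "y \<in> N" for x y
      proof -
        have "g \<otimes> (x \<otimes> y) \<otimes> inv g \<in> V" if g: "g \<in> carrier G" for g
        proof -
          have "g \<otimes> x \<otimes> inv g \<in> V" "g \<otimes> y \<otimes> inv g \<in> V"
            using \<open>x \<in> N\<close> \<open>y \<in> N\<close> g by (auto simp: N_def)
          then have "(g \<otimes> x \<otimes> inv g) \<otimes> (g \<otimes> y \<otimes> inv g) \<in> V"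
            by (rule subgroup.m_closed[OF V(1)])
          then show ?thesis using \<open>x \<in> N\<close> \<open>y \<in> N\<close> g by (simp add: N_def m_assoc mult_inv_cancel_left)
        qed
        then show ?thesis using that by (simp add: N_def)
      qed
      show "inv x \<in> N" if "x \<in> N" for x
      proof -
        have "g \<otimes> inv x \<otimes> inv g \<in> V" if g: "g \<in> carrier G" for g
        proof -
          have "g \<otimes> x \<otimes> inv g \<in> V" using \<open>x \<in> N\<close> g by (auto simp: N_def)
          then have "inv (g \<otimes> x \<otimes> inv g) \<in> V" by (rule subgroup.m_inv_closed[OF V(1)])
          then show ?thesis using \<open>x \<in> N\<close> g by (simp add: N_def m_assoc inv_mult_group)
        qed
        then show ?thesis using that by (simp add: N_def)
      qed
    qed
    moreover have "k \<otimes> x \<otimes> inv k \<in> N" if k: "k \<in> carrier G" and x: "x \<in> N" for k x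
    proof -
      have "g \<otimes> (k \<otimes> x \<otimes> inv k) \<otimes> inv g \<in> V" if g: "g \<in> carrier G" for g
      proof -
        have "(g \<otimes> k) \<otimes> x \<otimes> inv (g \<otimes> k) \<in> V" using x g k by (simp add: N_def)
        then show ?thesis using x g k by (simp add: N_def m_assoc inv_mult_group)
      qed
      then show ?thesis using x k by (simp add: N_def)
    qed
    ultimately show ?thesis by (simp add: normal_inv_iff)
  qed
  moreover have "N \<subseteq> U"
  proof
    fix x assume "x \<in> N"
    then have "x \<in> carrier G" "\<one> \<otimes> x \<otimes> inv \<one> \<in> V" unfolding N_def using one_closed by blast+
    then show "x \<in> U" using V(3) by auto
  qed
  ultimately show ?thesis using that by blast
qed

lemma nat_pow_index_mem:
  assumes N: "N \<lhd> G" and card: "card (rcosets N) = k" and g: "g \<in> carrier G"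
  shows "g [^] k \<in> N"
proof -
  have sub: "subgroup N G" using N by (rule normal_imp_subgroup)
  let ?Q = "G Mod N"
  have Q: "group ?Q" using N by (rule normal.factorgroup_is_group)
  interpret \<pi>: group_hom G ?Q "\<lambda>g. N #> g"
    using normal.r_coset_hom_Mod[OF N] Q is_group by (simp add: group_hom_def group_hom_axioms_def)
  have "order ?Q = k" using card by (simp add: order_def FactGroup_def)
  then have "(N #> g) [^]\<^bsub>?Q\<^esub> k = \<one>\<^bsub>?Q\<^esub>"
    using group.pow_order_eq_1[OF Q] \<pi>.hom_closed[OF g] by blast
  then have "N #> (g [^] k) = N" using g by (simp add: \<pi>.hom_nat_pow FactGroup_def)
  then show ?thesis using rcos_self[OF nat_pow_closed[OF g, of k] sub] by simp
qed

text \<open>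
  The set of \<open>b\<close>-th powers is compact, hence closed.  It is also dense: modulo an open normal
  subgroup \<open>N\<close> the order of \<open>g\<close> divides some \<open>p ^ k\<close>, and \<open>b * c = p ^ k * l + 1\<close> makes \<open>g [^] c\<close>
  a \<open>b\<close>-th root of \<open>g\<close> modulo \<open>N\<close>.  This controls actions of \<open>G\<close> on finite sets that are not known
  to be continuous.
\<close>
lemma root_exists:
  assumes b: "coprime b p" and g: "g \<in> carrier G"
  shows "\<exists>y\<in>carrier G. y [^] (b::nat) = g"
proof (rule ccontr)
  assume none: "\<not> ?thesis"
  let ?I = "(\<lambda>y. y [^] b) ` carrier G"
  have "compactin T ?I"
    using image_compactin[OF _ continuous_map_nat_pow[of b], of "carrier G"] compact
    by (simp add: compact_space_def topspace_eq)
  then have "closedin T ?I" by (rule compactin_imp_closedin[OF Hausdorff])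
  then have "openin T (carrier G - ?I)" using topspace_eq by (metis openin_diff openin_topspace)
  then have "openin T {x \<in> carrier G. g \<otimes> x \<otimes> \<one> \<in> carrier G - ?I}"
    using g by (intro openin_translated_vimage) auto
  moreover have "g \<notin> ?I" using none by blast
  ultimately obtain N where N: "N \<lhd> G" "openin T N"
    and N_I: "N \<subseteq> {x \<in> carrier G. g \<otimes> x \<otimes> \<one> \<in> carrier G - ?I}"
    using open_normal_base[of "{x \<in> carrier G. g \<otimes> x \<otimes> \<one> \<in> carrier G - ?I}"] g by auto
  obtain k where k: "card (rcosets N) = p ^ k" using index[OF N] by blast
  have "coprime b (p ^ k)" using b by simp
  moreover have "b \<noteq> 0" using b prime_p by (metis coprime_0_left_iff not_prime_unit)
  ultimately obtain c l where cl: "b * c = p ^ k * l + 1"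
    using bezout_nat[of b "p ^ k"] by (metis coprime_imp_gcd_eq_1)
  have "(g [^] c) [^] b = g [^] (p ^ k * l + 1)" using g cl by (simp add: nat_pow_pow mult.commute)
  also have "\<dots> = g \<otimes> (g [^] (p ^ k)) [^] l"
    using g nat_pow_Suc2 by (simp add: nat_pow_pow del: nat_pow_Suc)
  finally have "g \<otimes> (g [^] (p ^ k)) [^] l \<in> ?I" using g by (metis image_eqI nat_pow_closed)
  moreover have "(g [^] (p ^ k)) [^] l \<in> N"
    by (rule subgroup_nat_pow_closed[OF normal_imp_subgroup[OF N(1)] nat_pow_index_mem[OF N(1) k g]])
  then have "g \<otimes> (g [^] (p ^ k)) [^] l \<notin> ?I" using N_I g by auto
  ultimately show False by contradiction
qed

text \<open>The set and its complement are unions of open cosets of \<open>N\<close>.\<close>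
lemma closedin_coset_vimage:
  assumes N: "N \<lhd> G" "openin T N"
  shows "closedin T {g \<in> carrier G. N #> g \<in> Y}"
proof -
  have sub: "subgroup N G" using N(1) by (rule normal_imp_subgroup)
  have "openin T {g \<in> carrier G. N #> g \<notin> Y}"
  proof (subst openin_subopen, intro ballI)
    fix g assume "g \<in> {g \<in> carrier G. N #> g \<notin> Y}"
    then have g: "g \<in> carrier G" "N #> g \<notin> Y" by auto
    have "N #> g \<subseteq> {g \<in> carrier G. N #> g \<notin> Y}"
    proof
      fix x assume x: "x \<in> N #> g"
      then have "N #> x = N #> g" using repr_independence[OF x g(1) sub] by simp
      moreover have "x \<in> carrier G" using x g(1) r_coset_subset_G[OF subgroup.subset[OF sub]] by blast
      ultimately show "x \<in> {g \<in> carrier G. N #> g \<notin> Y}" using g(2) by simp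
    qed
    then show "\<exists>U. openin T U \<and> g \<in> U \<and> U \<subseteq> {g \<in> carrier G. N #> g \<notin> Y}"
      using openin_r_coset[OF sub N(2) g(1)] rcos_self[OF g(1) sub] by blast
  qed
  then have "closedin T (topspace T - {g \<in> carrier G. N #> g \<notin> Y})" by blast
  moreover have "topspace T - {g \<in> carrier G. N #> g \<notin> Y} = {g \<in> carrier G. N #> g \<in> Y}"
    using topspace_eq by auto
  ultimately show ?thesis by simp
qed

lemma separating_open_normal:
  assumes F: "finite F" "F \<subseteq> carrier G"
  obtains N where "N \<lhd> G" "openin T N" "inj_on (\<lambda>g. N #> g) F"
proof -
  let ?D = "(\<lambda>(a, b). a \<otimes> inv b) ` (F \<times> F) - {\<one>}"
  have "finite ?D" "?D \<subseteq> topspace T" using F topspace_eq by auto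
  then have "closedin T ?D"
    using Hausdorff Hausdorff_imp_t1_space t1_space_closedin_finite by blast
  then have "openin T (topspace T - ?D)" by blast
  moreover have "\<one> \<in> topspace T - ?D" using topspace_eq by simp
  ultimately obtain N where N: "N \<lhd> G" "openin T N" "N \<subseteq> topspace T - ?D"
    by (rule open_normal_base)
  have sub: "subgroup N G" using N(1) by (rule normal_imp_subgroup)
  have "a = b" if ab: "a \<in> F" "b \<in> F" "N #> a = N #> b" for a b
  proof -
    have c: "a \<in> carrier G" "b \<in> carrier G" using ab F(2) by auto
    have "a \<otimes> inv b \<in> N"
      using subgroup.rcos_module_imp[OF sub is_group c(2), of a] rcos_self[OF c(1) sub] ab(3) by simp
    then have "a \<otimes> inv b \<notin> ?D" using N(3) by blast
    moreover have "a \<otimes> inv b \<in> (\<lambda>(a, b). a \<otimes> inv b) ` (F \<times> F)"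
      using ab by (intro image_eqI[of _ _ "(a, b)"]) auto
    ultimately have "a \<otimes> inv b = \<one>" by blast
    then show ?thesis using c by (metis inv_equality inv_inv inv_closed)
  qed
  then show ?thesis using that N by (meson inj_onI)
qed

text \<open>
  The image of \<open>P\<close> in the quotient by \<open>N\<close> is a finite p-group of exponent dividing \<open>q\<close>.  It
  inherits the rank bound \<open>r\<close>: a subgroup \<open>K\<close> of it has a closed preimage in \<open>P\<close>, and topological
  generators of the preimage map to generators of \<open>K\<close>, since each coset of \<open>N\<close> is open and so meets
  the dense subgroup that they generate.
\<close>
lemma card_image_bounded_exponent_le:
  assumes P: "P = {g \<in> carrier G. g [^] q = \<one>}" "subgroup P G" and q: "0 < (q::nat)"
    and rank: "\<And>H. subgroup H G \<Longrightarrow> closedin T H \<Longrightarrow>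
         \<exists>S. S \<subseteq> H \<and> finite S \<and> card S \<le> r \<and> T closure_of (generate G S) = H"
    and N: "N \<lhd> G" "openin T N"
  shows "finite ((\<lambda>g. N #> g) ` P) \<and> card ((\<lambda>g. N #> g) ` P) \<le> q ^ r * (q ^ r) ^ r"
proof -
  let ?Q = "G Mod N" and ?\<pi> = "\<lambda>g. N #> g"
  have Nsub: "subgroup N G" using N(1) by (rule normal_imp_subgroup)
  have Q: "group ?Q" using N(1) by (rule normal.factorgroup_is_group)
  interpret \<pi>: group_hom G ?Q ?\<pi>
    using normal.r_coset_hom_Mod[OF N(1)] Q is_group by (simp add: group_hom_def group_hom_axioms_def)
  let ?P = "?\<pi> ` P"
  let ?M = "?Q\<lparr>carrier := ?P\<rparr>"
  have Psub: "subgroup ?P ?Q" using P(2) by (rule \<pi>.subgroup_img_is_subgroup)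
  interpret M: group ?M using Psub Q by (rule subgroup.subgroup_is_group)
  obtain k where k: "card (rcosets N) = p ^ k" using index[OF N] by blast
  have "card ?P dvd p ^ k"
    using group.lagrange[OF Q Psub] k by (metis dvd_triv_right order_def FactGroup_def partial_object.select_convs(1))
  then obtain j where "card ?P = p ^ j" using prime_p by (auto simp: divides_primepow_nat)
  then have j: "order ?M = p ^ j" by (simp add: order_def)
  have closed_P: "closedin T P"
    using closedin_continuous_map_preimage[OF continuous_map_nat_pow[of q], of "{\<one>}"]
      closedin_t1_singleton[OF Hausdorff_imp_t1_space[OF Hausdorff], of \<one>]
    by (simp add: P(1) topspace_eq)
  have "order ?M \<le> q ^ r * (q ^ r) ^ r"
  proof (rule M.order_le_of_rank_exponent[OF prime_p j q])
    show "x [^]\<^bsub>?M\<^esub> q = \<one>\<^bsub>?M\<^esub>" if "x \<in> carrier ?M" for x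
    proof -
      obtain g where g: "g \<in> carrier G" "g [^] q = \<one>" "x = ?\<pi> g" using \<open>x \<in> carrier ?M\<close> P(1) by auto
      have "x [^]\<^bsub>?Q\<^esub> q = ?\<pi> (g [^] q)" using \<pi>.hom_nat_pow[OF g(1), of q] g(3) by metis
      also have "\<dots> = \<one>\<^bsub>?Q\<^esub>" using g(2) \<pi>.hom_one by metis
      finally have "x [^]\<^bsub>?Q\<^esub> q = \<one>\<^bsub>?Q\<^esub>" .
      then show ?thesis by (simp add: nat_pow_def)
    qed
    show "\<exists>S. S \<subseteq> K \<and> finite S \<and> card S \<le> r \<and> generate ?M S = K" if K: "subgroup K ?M" for K
    proof -
      have KQ: "subgroup K ?Q" using group.incl_subgroup[OF Q Psub K] .
      have K_P: "K \<subseteq> ?P" using subgroup.subset[OF K] by simp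
      let ?H = "P \<inter> {g \<in> carrier G. ?\<pi> g \<in> K}"
      have "subgroup {g \<in> carrier G. ?\<pi> g \<in> K} G"
      proof
        show "\<one> \<in> {g \<in> carrier G. ?\<pi> g \<in> K}" using subgroup.one_closed[OF KQ] \<pi>.hom_one by auto
        show "x \<otimes> y \<in> {g \<in> carrier G. ?\<pi> g \<in> K}"
          if "x \<in> {g \<in> carrier G. ?\<pi> g \<in> K}" "y \<in> {g \<in> carrier G. ?\<pi> g \<in> K}" for x y
          using that subgroup.m_closed[OF KQ] \<pi>.hom_mult by fastforce
        show "inv x \<in> {g \<in> carrier G. ?\<pi> g \<in> K}" if "x \<in> {g \<in> carrier G. ?\<pi> g \<in> K}" for x
          using that subgroup.m_inv_closed[OF KQ] \<pi>.hom_inv by fastforce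
      qed auto
      then have "subgroup ?H G" using P(2) by (rule subgroups_Inter_pair[rotated])
      moreover have "closedin T ?H" using closed_P closedin_coset_vimage[OF N] by (rule closedin_Int)
      ultimately have "\<exists>S. S \<subseteq> ?H \<and> finite S \<and> card S \<le> r \<and> T closure_of (generate G S) = ?H"
        by (rule rank)
      then obtain S where S: "S \<subseteq> ?H" "finite S" "card S \<le> r" "T closure_of (generate G S) = ?H"
        by (elim exE conjE)
      have S_carr: "S \<subseteq> carrier G" using S(1) by blast
      have img: "generate ?Q (?\<pi> ` S) = ?\<pi> ` generate G S" using S_carr by (rule \<pi>.generate_img)
      have "generate ?M (?\<pi> ` S) = generate ?Q (?\<pi> ` S)"
        using S(1) by (intro group.generate_consistent[OF Q _ Psub]) blast
      also have "\<dots> = K"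
      proof
        show "generate ?Q (?\<pi> ` S) \<subseteq> K" using S(1) by (intro group.generate_subgroup_incl[OF Q _ KQ]) blast
        show "K \<subseteq> generate ?Q (?\<pi> ` S)"
        proof
          fix X assume "X \<in> K"
          then obtain g where g: "g \<in> P" "X = ?\<pi> g" using K_P by blast
          have gc: "g \<in> carrier G" using g(1) P(1) by simp
          have "g \<in> T closure_of (generate G S)" using S(4) g \<open>X \<in> K\<close> gc by simp
          then obtain y where y: "y \<in> generate G S" "y \<in> N #> g"
            using openin_r_coset[OF Nsub N(2) gc] rcos_self[OF gc Nsub] unfolding in_closure_of by blast
          have "X = ?\<pi> y" using repr_independence[OF y(2) gc Nsub] g(2) by simp
          then show "X \<in> generate ?Q (?\<pi> ` S)" using y(1) img by blast
        qed
      qed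
      finally have "generate ?M (?\<pi> ` S) = K" .
      moreover have "?\<pi> ` S \<subseteq> K" using S(1) by blast
      moreover have "card (?\<pi> ` S) \<le> r" using card_image_le[OF S(2), of ?\<pi>] S(3) by linarith
      ultimately show ?thesis using S(2) by blast
    qed
  qed
  moreover have "finite ?P"
    using \<open>card ?P = p ^ j\<close> prime_p by (metis card.infinite not_prime_0 power_not_zero)
  ultimately show ?thesis by (simp add: order_def)
qed

text \<open>
  Any finite subset of \<open>P\<close> injects into the quotient by a small enough open normal subgroup, where
  the image of \<open>P\<close> has at most \<open>q ^ r * (q ^ r) ^ r\<close> elements.
\<close>
lemma finite_bounded_exponent_subgroup:
  assumes P: "P = {g \<in> carrier G. g [^] q = \<one>}" "subgroup P G" and q: "0 < (q::nat)"
    and rank: "finite_rank G T"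
  shows "finite P"
proof (rule ccontr)
  assume inf: "infinite P"
  obtain r :: nat where r: "\<And>H. subgroup H G \<Longrightarrow> closedin T H \<Longrightarrow>
       \<exists>S. S \<subseteq> H \<and> finite S \<and> card S \<le> r \<and> T closure_of (generate G S) = H"
    using rank unfolding finite_rank_def by blast
  let ?B = "q ^ r * (q ^ r) ^ r"
  obtain F where F: "finite F" "card F = Suc ?B" "F \<subseteq> P"
    using infinite_arbitrarily_large[OF inf] by blast
  have "F \<subseteq> carrier G" using F(3) P(1) by blast
  then obtain N where N: "N \<lhd> G" "openin T N" "inj_on (\<lambda>g. N #> g) F"
    by (rule separating_open_normal[OF F(1)])
  have bound: "finite ((\<lambda>g. N #> g) ` P)" "card ((\<lambda>g. N #> g) ` P) \<le> ?B"
    using card_image_bounded_exponent_le[OF P q r N(1,2)] by auto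
  have "card F = card ((\<lambda>g. N #> g) ` F)" using N(3) by (simp add: card_image)
  also have "\<dots> \<le> card ((\<lambda>g. N #> g) ` P)" using bound(1) F(3) by (intro card_mono image_mono)
  finally show False using bound(2) F(2) by simp
qed

end

section \<open>Actions on finite sets\<close>

text \<open>
  Only the values of \<open>\<alpha>\<close> on \<open>E\<close> matter, whereas \<open>group_action\<close> demands extensional maps.
  So conjugation, the action on letters and the action on words are instances as they stand.
\<close>
locale set_action = group G for G (structure) +
  fixes \<alpha> :: "'a \<Rightarrow> 'x \<Rightarrow> 'x" and E :: "'x set"
  assumes act_closed: "\<lbrakk>g \<in> carrier G; x \<in> E\<rbrakk> \<Longrightarrow> \<alpha> g x \<in> E"
    and act_one: "x \<in> E \<Longrightarrow> \<alpha> \<one> x = x"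
    and act_mult: "\<lbrakk>g \<in> carrier G; h \<in> carrier G; x \<in> E\<rbrakk> \<Longrightarrow> \<alpha> (g \<otimes> h) x = \<alpha> g (\<alpha> h x)"
begin

lemma act_inv:
  assumes "g \<in> carrier G" "x \<in> E"
  shows "\<alpha> (inv g) (\<alpha> g x) = x" "\<alpha> g (\<alpha> (inv g) x) = x"
  using assms by (simp_all add: act_mult[symmetric] act_one)

lemma act_inj: "\<lbrakk>g \<in> carrier G; x \<in> E; y \<in> E; \<alpha> g x = \<alpha> g y\<rbrakk> \<Longrightarrow> x = y"
  by (metis act_inv(1))

lemma fixed_nat_pow:
  assumes "g \<in> carrier G" "x \<in> E" "\<alpha> g x = x"
  shows "\<alpha> (g [^] (k::nat)) x = x"
  using assms by (induction k) (simp_all add: act_one act_mult)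

lemma act_pow_diff:
  assumes "g \<in> carrier G" "x \<in> E" "i < j" "\<alpha> (g [^] (i::nat)) x = \<alpha> (g [^] j) x"
  shows "\<alpha> (g [^] (j - i)) x = x"
proof -
  have "g [^] j = g [^] i \<otimes> g [^] (j - i)" using assms(1,3) by (simp add: nat_pow_mult)
  then have "\<alpha> (g [^] i) x = \<alpha> (g [^] i) (\<alpha> (g [^] (j - i)) x)"
    using assms by (simp add: act_mult)
  then show ?thesis using assms(1,2) by (metis act_inj act_closed nat_pow_closed)
qed

text \<open>Each orbit of \<open>g\<close> is a cycle of length at most \<open>card E\<close>, and this length divides \<open>fact (card E)\<close>.\<close>
lemma pow_fact_fixes:
  assumes E: "finite E" and g: "g \<in> carrier G" and x: "x \<in> E"
  shows "\<alpha> (g [^] (fact (card E) :: nat)) x = x"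
proof -
  let ?o = "\<lambda>i::nat. \<alpha> (g [^] i) x"
  have "?o ` {..card E} \<subseteq> E" using act_closed g x by auto
  then have "card (?o ` {..card E}) \<le> card E" using E by (rule card_mono[rotated])
  then have "\<not> inj_on ?o {..card E}" using card_image by force
  then obtain i j where "i < j" "j \<le> card E" "?o i = ?o j"
    by (metis (mono_tags, lifting) atMost_iff linorder_inj_onI' order_le_less)
  define d where "d = j - i"
  have d: "\<alpha> (g [^] d) x = x" "1 \<le> d" "d \<le> card E"
    using act_pow_diff[OF g x \<open>i < j\<close> \<open>?o i = ?o j\<close>] \<open>i < j\<close> \<open>j \<le> card E\<close> by (auto simp: d_def)
  then obtain k where "(fact (card E) :: nat) = d * k" using dvd_fact[of d "card E"] by blast
  then show ?thesis using fixed_nat_pow[OF _ x d(1), of k] g by (simp add: nat_pow_pow)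
qed

text \<open>
  With \<open>y\<close> a \<open>b\<close>-th root of \<open>g\<close>, \<open>g [^] c = y [^] (c * b)\<close>.  Taking \<open>b\<close> to be the part of the
  factorial prime to \<open>p\<close> shows that \<open>g\<close> permutes \<open>E\<close> with p-power order.
\<close>
lemma pow_fixes:
  assumes roots: "\<And>b. coprime b p \<Longrightarrow> \<exists>y\<in>carrier G. y [^] (b::nat) = g"
    and E: "finite E" and x: "x \<in> E" and c: "fact (card E) = c * (b::nat)" "coprime b p"
  shows "\<alpha> (g [^] c) x = x"
proof -
  obtain y where y: "y \<in> carrier G" "y [^] b = g" using roots[of b] c by auto
  then have "g [^] c = y [^] (fact (card E) :: nat)" using c(1) by (auto simp: nat_pow_pow mult.commute)
  then show ?thesis using pow_fact_fixes[OF E y(1) x] by simp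
qed

text \<open>An orbit length that divides the prime \<open>card E\<close> is 1 or \<open>card E\<close>.\<close>
lemma prime_cycle:
  assumes p: "Factorial_Ring.prime (card E)" and g: "g \<in> carrier G" and x: "x \<in> E"
    and moved: "\<alpha> g x \<noteq> x" and pow: "\<alpha> (g [^] card E) x = x" and y: "y \<in> E"
  obtains i :: nat where "\<alpha> (g [^] i) x = y"
proof -
  let ?p = "card E" and ?o = "\<lambda>i::nat. \<alpha> (g [^] i) x"
  have fin: "finite E" using p by (metis card.infinite not_prime_0)
  have "inj_on ?o {..<?p}"
  proof (rule linorder_inj_onI')
    fix i j assume ij: "i \<in> {..<?p}" "j \<in> {..<?p}" "i < j"
    show "?o i \<noteq> ?o j"
    proof
      assume "?o i = ?o j"
      define d where "d = j - i"
      have d: "\<alpha> (g [^] d) x = x" "0 < d" "d < ?p"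
        using act_pow_diff[OF g x \<open>i < j\<close> \<open>?o i = ?o j\<close>] ij by (auto simp: d_def)
      then have "coprime d ?p"
        using p by (metis coprime_commute nat_dvd_not_less prime_imp_coprime_nat)
      then obtain k l where kl: "d * k = ?p * l + 1"
        using d(2) bezout_nat[of d ?p] by (metis coprime_imp_gcd_eq_1 less_not_refl)
      have "\<alpha> (g [^] (d * k)) x = x"
        using fixed_nat_pow[OF _ x d(1), of k] g by (simp add: nat_pow_pow)
      moreover have "g [^] (d * k) = g \<otimes> (g [^] ?p) [^] l"
        unfolding kl using g nat_pow_Suc2 by (simp add: nat_pow_pow del: nat_pow_Suc)
      ultimately have "\<alpha> g (\<alpha> ((g [^] ?p) [^] l) x) = x" using g x by (simp add: act_mult)
      then show False using moved fixed_nat_pow[OF _ x pow, of l] g by simp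
    qed
  qed
  then have "card (?o ` {..<?p}) = ?p" by (simp add: card_image)
  moreover have "?o ` {..<?p} \<subseteq> E" using g x act_closed by auto
  ultimately have "?o ` {..<?p} = E" using fin by (simp add: card_subset_eq)
  then have "y \<in> ?o ` {..<?p}" using y by simp
  then obtain i where "y = ?o i" by (rule imageE)
  then show ?thesis using that by simp
qed

end

section \<open>Simple virtual endomorphisms of prime index\<close>

text \<open>
  Prime index enters only as \<open>cyclic_quotient\<close>: every nontrivial element generates the quotient by
  \<open>H\<close>.  The simplicity of \<open>f\<close> is \<open>core_trivial\<close>.
\<close>
locale simple_virtual_endomorphism = normal H G for H and G (structure) +
  fixes f :: "'a \<Rightarrow> 'a"
  assumes f_closed: "x \<in> H \<Longrightarrow> f x \<in> carrier G"
    and f_mult: "\<lbrakk>x \<in> H; y \<in> H\<rbrakk> \<Longrightarrow> f (x \<otimes> y) = f x \<otimes> f y"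
    and core_trivial: "\<lbrakk>K \<lhd> G; K \<subseteq> H; f ` K \<subseteq> K\<rbrakk> \<Longrightarrow> K = {\<one>}"
    and cyclic_quotient:
      "\<lbrakk>u \<in> carrier G; u \<notin> H; g \<in> carrier G\<rbrakk> \<Longrightarrow> \<exists>j::nat. g \<otimes> u [^] j \<in> H"
begin

lemma subgroup_H: "subgroup H G" by (rule subgroup_axioms)

lemma H_carrier: "x \<in> H \<Longrightarrow> x \<in> carrier G" by (rule mem_carrier)

lemma f_hom: "group_hom (G\<lparr>carrier := H\<rparr>) G f"
  using subgroup_H f_closed f_mult
  by (intro group_hom.intro group_hom_axioms.intro is_group) (auto simp: hom_def subgroup_imp_group)

lemma f_one: "f \<one> = \<one>"
  using group_hom.hom_one[OF f_hom] by simp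

lemma f_inv: "x \<in> H \<Longrightarrow> f (inv x) = inv (f x)"
  using group_hom.hom_inv[OF f_hom] m_inv_consistent[OF subgroup_H] by simp

lemma f_nat_pow: "x \<in> H \<Longrightarrow> f (x [^] (k::nat)) = f x [^] k"
  by (induction k) (auto simp: f_one f_mult subgroup_nat_pow_closed[OF subgroup_H])

lemma H_conj: "\<lbrakk>x \<in> H; g \<in> carrier G\<rbrakk> \<Longrightarrow> g \<otimes> x \<otimes> inv g \<in> H"
  by (rule inv_op_closed2)

lemma vimage_subgroup:
  assumes "subgroup K G"
  shows "subgroup {x \<in> H. f x \<in> K} G"
  using assms
  by unfold_locales
    (auto simp: H_carrier f_mult f_inv f_one subgroup.one_closed subgroup.m_closed subgroup.m_inv_closed)

text \<open>The form in which simplicity is used: for a set of generators instead of a subgroup.\<close>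
lemma invariant_subset_trivial:
  assumes S: "S \<subseteq> H" and conj: "\<And>s g. \<lbrakk>s \<in> S; g \<in> carrier G\<rbrakk> \<Longrightarrow> g \<otimes> s \<otimes> inv g \<in> S"
    and f: "f ` S \<subseteq> generate G S"
  shows "S \<subseteq> {\<one>}"
proof -
  have carr: "S \<subseteq> carrier G" using S subset by blast
  have normal: "generate G S \<lhd> G"
    using carr conj by (intro normal_generateI)
  have "generate G S \<subseteq> {x \<in> H. f x \<in> generate G S}"
    using S f by (intro generate_subgroup_incl vimage_subgroup generate_is_subgroup carr) auto
  then have "generate G S = {\<one>}"
    using normal by (intro core_trivial) auto
  then show ?thesis using generate.incl by fast
qed

text \<open>
  For the action on a tree this is faithfulness on the first-level subtrees: the elements
  \<open>f (g \<otimes> y \<otimes> inv g)\<close> are, up to conjugation, the states of \<open>y\<close> at the first-level vertices.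
\<close>
lemma common_kernel_trivial:
  assumes "y \<in> H" "\<And>g. g \<in> carrier G \<Longrightarrow> f (g \<otimes> y \<otimes> inv g) = \<one>"
  shows "y = \<one>"
proof -
  let ?S = "{g \<otimes> y \<otimes> inv g | g. g \<in> carrier G}"
  have "?S \<subseteq> {\<one>}"
  proof (rule invariant_subset_trivial)
    show "?S \<subseteq> H" using assms(1) H_conj by blast
    show "g \<otimes> s \<otimes> inv g \<in> ?S" if "s \<in> ?S" "g \<in> carrier G" for s g
    proof -
      obtain k where k: "k \<in> carrier G" "s = k \<otimes> y \<otimes> inv k" using \<open>s \<in> ?S\<close> by blast
      have "g \<otimes> s \<otimes> inv g = (g \<otimes> k) \<otimes> y \<otimes> inv (g \<otimes> k)"
        using k \<open>g \<in> carrier G\<close> assms(1) H_carrier by (simp add: inv_mult_group m_assoc)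
      then show ?thesis using k \<open>g \<in> carrier G\<close> by blast
    qed
    show "f ` ?S \<subseteq> generate G ?S" using assms(2) by (auto intro: generate.one)
  qed
  moreover have "y \<in> ?S" using assms(1) H_carrier by (auto intro!: exI[of _ \<one>])
  ultimately show ?thesis by blast
qed

text \<open>
  The domain of \<open>f ^^ i\<close> as a partial map; for the action on a tree, the stabilizer of the vertex
  \<open>replicate i 0\<close>.
\<close>
primrec iterate_dom :: "nat \<Rightarrow> 'a set" where
  "iterate_dom 0 = carrier G"
| "iterate_dom (Suc i) = {x \<in> H. f x \<in> iterate_dom i}"

lemma iterate_dom_subgroup: "subgroup (iterate_dom i) G"
  by (induction i) (auto simp: subgroup_self vimage_subgroup)

lemma iterate_dom_carrier: "x \<in> iterate_dom i \<Longrightarrow> x \<in> carrier G"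
  using iterate_dom_subgroup by (rule subgroup.mem_carrier)

lemma iter_closed: "x \<in> iterate_dom i \<Longrightarrow> (f ^^ i) x \<in> carrier G"
  by (induction i arbitrary: x) (auto simp: funpow_swap1)

lemma iter_mult: "\<lbrakk>x \<in> iterate_dom i; y \<in> iterate_dom i\<rbrakk> \<Longrightarrow> (f ^^ i) (x \<otimes> y) = (f ^^ i) x \<otimes> (f ^^ i) y"
  by (induction i arbitrary: x y) (auto simp: funpow_swap1 f_mult)

lemma iter_inv: "x \<in> iterate_dom i \<Longrightarrow> (f ^^ i) (inv x) = inv ((f ^^ i) x)"
  by (induction i arbitrary: x) (auto simp: funpow_swap1 f_inv)

lemma iter_nat_pow: "x \<in> iterate_dom i \<Longrightarrow> (f ^^ i) (x [^] (k::nat)) = (f ^^ i) x [^] k"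
  by (induction i arbitrary: x) (auto simp: funpow_swap1 f_nat_pow)

lemma iterate_dom_Suc: "iterate_dom (Suc i) = {x \<in> iterate_dom i. (f ^^ i) x \<in> H}"
proof (induction i)
  case 0
  show ?case using H_carrier f_closed by auto
next
  case (Suc i)
  have "f x \<in> iterate_dom (Suc i) \<longleftrightarrow> f x \<in> iterate_dom i \<and> (f ^^ i) (f x) \<in> H" for x
    unfolding Suc.IH by simp
  then show ?case by (auto simp: funpow_swap1)
qed

end

locale torsion_simple_virtual_endomorphism = simple_virtual_endomorphism +
  fixes q :: nat and P :: "'a set"
  assumes P_def: "P = {g \<in> carrier G. g [^] q = \<one>}"
    and P_subgroup: "subgroup P G" and P_finite: "finite P" and P_nontrivial: "P \<noteq> {\<one>}"
begin

lemma P_carrier: "x \<in> P \<Longrightarrow> x \<in> carrier G"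
  by (simp add: P_def)

lemma P_conj: "\<lbrakk>x \<in> P; g \<in> carrier G\<rbrakk> \<Longrightarrow> g \<otimes> x \<otimes> inv g \<in> P"
  by (simp add: P_def conj_nat_pow)

lemma P_normal: "P \<lhd> G"
  using P_subgroup P_conj by (simp add: normal_inv_iff)

lemma f_P: "\<lbrakk>x \<in> P; x \<in> H\<rbrakk> \<Longrightarrow> f x \<in> P"
  using f_nat_pow[of x q] f_one f_closed by (simp add: P_def)

lemma iter_P: "\<lbrakk>x \<in> P; x \<in> iterate_dom i\<rbrakk> \<Longrightarrow> (f ^^ i) x \<in> P"
  by (induction i arbitrary: x) (auto simp: funpow_swap1 f_P)

text \<open>Otherwise \<open>P\<close> itself would be a nontrivial \<open>f\<close>-invariant normal subgroup inside \<open>H\<close>.\<close>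
lemma P_not_le_H: "\<not> P \<subseteq> H"
  using core_trivial[OF P_normal] f_P P_nontrivial by blast

lemma factor_through_P:
  assumes "g \<in> carrier G"
  obtains h u where "h \<in> H" "u \<in> P" "g = h \<otimes> u"
proof -
  obtain v where v: "v \<in> P" "v \<notin> H" using P_not_le_H by blast
  then obtain j :: nat where j: "g \<otimes> v [^] j \<in> H"
    using cyclic_quotient[OF P_carrier] assms by blast
  have "v [^] j \<in> P" using v P_subgroup by (intro subgroup_nat_pow_closed)
  moreover from this have "g = (g \<otimes> v [^] j) \<otimes> inv (v [^] j)"
    using assms P_carrier v by (simp add: m_assoc)
  ultimately show ?thesis using that[of "g \<otimes> v [^] j" "inv (v [^] j)"] j P_subgroup
    by (simp add: subgroup.m_inv_closed)
qed

text \<open>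
  Write \<open>g = h \<otimes> u\<close> with \<open>h \<in> H\<close> and \<open>u \<in> P\<close>.  The commutator of \<open>u\<close> and \<open>x\<close> lies in \<open>P \<inter> H\<close>, so
  modulo \<open>P\<close> the element \<open>f (g \<otimes> x \<otimes> inv g)\<close> is a conjugate of \<open>f x\<close>, that is, trivial.  Hence
  \<open>x [^] q\<close> lies in the common kernel.
\<close>
lemma f_reflects_P:
  assumes x: "x \<in> H" and fx: "f x \<in> P"
  shows "x \<in> P"
proof -
  have xc: "x \<in> carrier G" using x H_carrier by blast
  have "f (g \<otimes> x \<otimes> inv g) \<in> P" if "g \<in> carrier G" for g
  proof -
    obtain h u where hu: "h \<in> H" "u \<in> P" "g = h \<otimes> u"
      by (rule factor_through_P[OF \<open>g \<in> carrier G\<close>])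
    have c: "h \<in> carrier G" "u \<in> carrier G" using hu H_carrier P_carrier by auto
    let ?k = "u \<otimes> x \<otimes> inv u \<otimes> inv x"
    have kH: "?k \<in> H" using x c H_conj by (simp add: m_closed)
    have "?k = u \<otimes> (x \<otimes> inv u \<otimes> inv x)" using c xc by (simp add: m_assoc)
    then have "?k \<in> P" using hu P_conj xc P_subgroup
      by (simp add: subgroup.m_closed subgroup.m_inv_closed)
    then have "f ?k \<otimes> f x \<in> P" using f_P kH fx P_subgroup by (simp add: subgroup.m_closed)
    moreover have "g \<otimes> x \<otimes> inv g = h \<otimes> (?k \<otimes> x) \<otimes> inv h"
      using hu c xc by (simp add: m_assoc inv_mult_group mult_inv_cancel_left)
    moreover have "f (h \<otimes> (?k \<otimes> x) \<otimes> inv h) = f h \<otimes> (f ?k \<otimes> f x) \<otimes> inv (f h)"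
      using hu(1) x kH by (simp add: f_mult f_inv m_closed)
    ultimately show ?thesis using P_conj f_closed hu(1) by simp
  qed
  then have "f (g \<otimes> x [^] q \<otimes> inv g) = \<one>" if "g \<in> carrier G" for g
    using that xc x H_conj by (simp add: P_def conj_nat_pow[symmetric] f_nat_pow)
  then have "x [^] q = \<one>"
    by (rule common_kernel_trivial[OF subgroup_nat_pow_closed[OF subgroup_H x]])
  then show ?thesis using xc by (simp add: P_def)
qed

lemma iter_reflects_P: "\<lbrakk>x \<in> iterate_dom i; (f ^^ i) x \<in> P\<rbrakk> \<Longrightarrow> x \<in> P"
  by (induction i arbitrary: x) (auto simp: funpow_swap1 f_reflects_P)

text \<open>
  For \<open>g = h \<otimes> u\<close> with \<open>h \<in> H\<close> and \<open>u \<in> P\<close>, \<open>g [^] s\<close> is \<open>h [^] s\<close> times an element of \<open>P\<close>,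
  which commutes with \<open>h [^] s\<close> and is killed by \<open>q\<close>.  So \<open>g [^] (s * q) = h [^] (s * q)\<close>, and the
  set of \<open>s * q\<close>-th powers, all taken on \<open>H\<close>, is mapped by \<open>f\<close> into itself.
\<close>
lemma torsion:
  assumes s: "\<And>g x. \<lbrakk>g \<in> carrier G; x \<in> P\<rbrakk> \<Longrightarrow> g [^] (s::nat) \<otimes> x = x \<otimes> g [^] s"
    and s': "\<And>g. g \<in> carrier G \<Longrightarrow> g [^] s \<in> H"
    and g: "g \<in> carrier G"
  shows "g [^] (s * q) = \<one>"
proof -
  let ?S = "{g [^] (s * q) | g. g \<in> carrier G}"
  have "?S \<subseteq> {\<one>}"
  proof (rule invariant_subset_trivial)
    show "?S \<subseteq> H"
    proof clarsimp
      fix g assume "g \<in> carrier G"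
      then have "(g [^] s) [^] q \<in> H" using s' subgroup_nat_pow_closed[OF subgroup_H] by blast
      then show "g [^] (s * q) \<in> H" using \<open>g \<in> carrier G\<close> by (simp add: nat_pow_pow)
    qed
    show "g \<otimes> t \<otimes> inv g \<in> ?S" if "t \<in> ?S" "g \<in> carrier G" for t g
    proof -
      obtain k where k: "k \<in> carrier G" "t = k [^] (s * q)" using \<open>t \<in> ?S\<close> by blast
      have "g \<otimes> t \<otimes> inv g = (g \<otimes> k \<otimes> inv g) [^] (s * q)"
        using k \<open>g \<in> carrier G\<close> by (simp add: conj_nat_pow)
      then show ?thesis using k \<open>g \<in> carrier G\<close> by blast
    qed
    have "f (g [^] (s * q)) \<in> ?S" if "g \<in> carrier G" for g
    proof -
      obtain h u where hu: "h \<in> H" "u \<in> P" "g = h \<otimes> u"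
        by (rule factor_through_P[OF \<open>g \<in> carrier G\<close>])
      have hc: "h \<in> carrier G" using hu H_carrier by blast
      obtain v where v: "v \<in> P" "g [^] s = h [^] s \<otimes> v"
        using normal_mult_nat_pow[OF P_normal hc hu(2), of s] hu(3) by blast
      have "g [^] (s * q) = (h [^] s \<otimes> v) [^] q"
        using v(2) \<open>g \<in> carrier G\<close> nat_pow_pow by metis
      also have "\<dots> = (h [^] s) [^] q \<otimes> v [^] q"
        using s[OF hc v(1)] hc v(1) P_carrier by (intro pow_mult_distrib) auto
      also have "\<dots> = h [^] (s * q)" using v(1) hc by (simp add: P_def nat_pow_pow)
      finally have "f (g [^] (s * q)) = f h [^] (s * q)" using hu(1) by (simp add: f_nat_pow)
      then show ?thesis using f_closed hu(1) by blast
    qed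
    then show "f ` ?S \<subseteq> generate G ?S" by (auto intro!: generate.incl)
  qed
  then show ?thesis using g by blast
qed

text \<open>
  The decreasing chain of the finite groups \<open>P \<inter> iterate_dom i\<close> becomes stationary.  The first such
  index is a successor because \<open>P\<close> is not contained in \<open>H\<close>.
\<close>
lemma stable_level:
  obtains m where "P \<inter> iterate_dom (Suc (Suc m)) = P \<inter> iterate_dom (Suc m)"
    and "\<And>i. i \<le> m \<Longrightarrow> P \<inter> iterate_dom (Suc i) \<noteq> P \<inter> iterate_dom i"
proof -
  let ?stable = "\<lambda>i. P \<inter> iterate_dom (Suc i) = P \<inter> iterate_dom i"
  have "\<exists>i. ?stable i"
  proof (rule ccontr)
    assume "\<not> ?thesis"
    then have less: "card (P \<inter> iterate_dom (Suc i)) < card (P \<inter> iterate_dom i)" for i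
      using P_finite by (intro psubset_card_mono) (auto simp: iterate_dom_Suc simp del: iterate_dom.simps)
    have "card (P \<inter> iterate_dom i) + i \<le> card (P \<inter> iterate_dom 0)" for i
    proof (induction i)
      case (Suc i)
      then show ?case using less[of i] by linarith
    qed simp
    from this[of "Suc (card (P \<inter> iterate_dom 0))"] show False by simp
  qed
  moreover have "\<not> ?stable 0" using P_not_le_H P_carrier f_closed by auto
  ultimately obtain m where "?stable (Suc m)" "\<forall>i\<le>m. \<not> ?stable i"
    using ex_least_nat_less[of ?stable] by metis
  then show ?thesis using that[of m] by blast
qed

lemma level_witness:
  assumes "P \<inter> iterate_dom (Suc i) \<noteq> P \<inter> iterate_dom i"
  obtains e where "e \<in> P" "e \<in> iterate_dom i" "(f ^^ i) e \<in> P" "(f ^^ i) e \<notin> H"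
proof -
  obtain e where "e \<in> P" "e \<in> iterate_dom i" "e \<notin> iterate_dom (Suc i)"
    using assms unfolding iterate_dom_Suc by blast
  then show ?thesis using that[of e] iter_P[of e i] unfolding iterate_dom_Suc by blast
qed

text \<open>
  While the chain still decreases at \<open>i\<close>, some \<open>e \<in> P\<close> in the domain of \<open>f ^^ i\<close> has an image
  outside \<open>H\<close>; multiplying by powers of \<open>e\<close> brings the image of any element into \<open>H\<close>.
\<close>
lemma adjust_into_iterate_dom:
  assumes strict: "\<And>i. i \<le> m \<Longrightarrow> P \<inter> iterate_dom (Suc i) \<noteq> P \<inter> iterate_dom i"
    and "i \<le> Suc m" and g: "g \<in> carrier G"
  shows "\<exists>u\<in>P. g \<otimes> u \<in> iterate_dom i"
  using assms(2)
proof (induction i)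
  case 0
  show ?case using g subgroup.one_closed[OF P_subgroup] by (intro bexI[of _ \<one>]) auto
next
  case (Suc i)
  then obtain u where u: "u \<in> P" "g \<otimes> u \<in> iterate_dom i" by auto
  obtain e where e: "e \<in> P" "e \<in> iterate_dom i" "(f ^^ i) e \<in> P" "(f ^^ i) e \<notin> H"
    using Suc.prems by (auto intro: level_witness[OF strict])
  obtain j :: nat where j: "(f ^^ i) (g \<otimes> u) \<otimes> (f ^^ i) e [^] j \<in> H"
    using cyclic_quotient[OF P_carrier[OF e(3)] e(4) iter_closed[OF u(2)]] by blast
  have ej: "e [^] j \<in> iterate_dom i" "e [^] j \<in> P"
    using e iterate_dom_subgroup P_subgroup by (auto intro: subgroup_nat_pow_closed)
  then have "g \<otimes> u \<otimes> e [^] j \<in> iterate_dom (Suc i)"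
    unfolding iterate_dom_Suc using j u(2) e(2) iterate_dom_subgroup
    by (auto simp: iter_mult iter_nat_pow subgroup.m_closed)
  then have "g \<otimes> (u \<otimes> e [^] j) \<in> iterate_dom (Suc i)"
    using g u(1) ej(2) P_carrier by (simp add: m_assoc del: iterate_dom.simps)
  then show ?case using u(1) ej(2) P_subgroup by (meson subgroup.m_closed)
qed

text \<open>
  Let \<open>Q\<close> be the stable term \<open>P \<inter> iterate_dom (Suc m)\<close> and \<open>R\<close> its image under \<open>f ^^ m\<close>; both are
  \<open>f\<close>-invariant subgroups of \<open>H\<close>.  By \<open>iterate_dom_Suc\<close> and the normality of \<open>H\<close>, \<open>Q\<close> is normal in
  \<open>P \<inter> iterate_dom m\<close>, which contains some \<open>e \<notin> Q\<close>.  So \<open>R\<close> is normalized by \<open>t = (f ^^ m) e\<close>,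
  which is not in \<open>H\<close>.  Then every conjugate of \<open>R\<close> in \<open>G\<close> is a conjugate by an element of \<open>H\<close>,
  \<open>f\<close> maps it into another conjugate of \<open>R\<close>, and simplicity makes \<open>R\<close> trivial.
\<close>
lemma iter_kills_stable_level:
  assumes stable: "P \<inter> iterate_dom (Suc (Suc m)) = P \<inter> iterate_dom (Suc m)"
    and strict: "P \<inter> iterate_dom (Suc m) \<noteq> P \<inter> iterate_dom m"
    and x: "x \<in> P" "x \<in> iterate_dom (Suc m)"
  shows "(f ^^ m) x = \<one>"
proof -
  let ?Q = "P \<inter> iterate_dom (Suc m)"
  let ?R = "(f ^^ m) ` ?Q"
  have f_Q: "f y \<in> ?Q" if "y \<in> ?Q" for y
  proof -
    have "y \<in> P \<inter> iterate_dom (Suc (Suc m))" using that stable by blast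
    then show ?thesis by (auto intro: f_P)
  qed
  have iter_Q: "(f ^^ i) y \<in> ?Q" if "y \<in> ?Q" for i y
    using that f_Q by (induction i) (simp_all del: iterate_dom.simps Int_iff)
  have f_R: "f r \<in> ?R" if "r \<in> ?R" for r
  proof -
    obtain y where y: "y \<in> ?Q" "r = (f ^^ m) y" using \<open>r \<in> ?R\<close> by blast
    then have "f r = (f ^^ m) (f y)" by (simp add: funpow_swap1)
    then show ?thesis using f_Q[OF y(1)] by blast
  qed
  have "?R \<subseteq> ?Q" using iter_Q by blast
  also have "?Q \<subseteq> H" by auto
  finally have R_H: "?R \<subseteq> H" .
  obtain e where e: "e \<in> P" "e \<in> iterate_dom m" "(f ^^ m) e \<in> P" "(f ^^ m) e \<notin> H"
    using level_witness[OF strict] .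
  define t where "t = (f ^^ m) e"
  have t: "t \<in> carrier G" "t \<notin> H" using e P_carrier by (auto simp: t_def)
  have conj_R: "t \<otimes> r \<otimes> inv t \<in> ?R" if "r \<in> ?R" for r
  proof -
    obtain y where y: "y \<in> P" "y \<in> iterate_dom m" "(f ^^ m) y \<in> H" "r = (f ^^ m) y"
      using \<open>r \<in> ?R\<close> unfolding iterate_dom_Suc by blast
    let ?z = "e \<otimes> y \<otimes> inv e"
    have z: "?z \<in> P" "?z \<in> iterate_dom m" 
      using e y P_conj P_carrier iterate_dom_subgroup[of m]
      by (auto simp: subgroup.m_closed subgroup.m_inv_closed)
    have "(f ^^ m) ?z = t \<otimes> r \<otimes> inv t"
      using e(2) y iterate_dom_subgroup[of m]
      by (simp add: iter_mult iter_inv t_def subgroup.m_closed subgroup.m_inv_closed)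
    moreover have "t \<otimes> r \<otimes> inv t \<in> H" using H_conj t(1) y by blast
    ultimately show ?thesis using z unfolding iterate_dom_Suc by (metis (mono_tags, lifting) IntI image_eqI mem_Collect_eq)
  qed
  have conj_pow_R: "t [^] (j::nat) \<otimes> r \<otimes> inv (t [^] j) \<in> ?R" if "r \<in> ?R" for j r
    using that
  proof (induction j)
    case 0
    then show ?case using R_H H_carrier by auto
  next
    case (Suc j)
    have "r \<in> carrier G" using Suc.prems R_H H_carrier by blast
    then have "t [^] Suc j \<otimes> r \<otimes> inv (t [^] Suc j) = t \<otimes> (t [^] j \<otimes> r \<otimes> inv (t [^] j)) \<otimes> inv t"
      using t(1) nat_pow_Suc2[OF t(1), of j] by (simp add: m_assoc inv_mult_group del: nat_pow_Suc)
    then show ?case using conj_R Suc by presburger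
  qed
  let ?S = "{g \<otimes> r \<otimes> inv g | g r. g \<in> carrier G \<and> r \<in> ?R}"
  have "?S \<subseteq> {\<one>}"
  proof (rule invariant_subset_trivial)
    show "?S \<subseteq> H" using R_H H_conj by blast
    show "g \<otimes> s \<otimes> inv g \<in> ?S" if "s \<in> ?S" "g \<in> carrier G" for s g
    proof -
      obtain k r where k: "k \<in> carrier G" "r \<in> ?R" "s = k \<otimes> r \<otimes> inv k" using \<open>s \<in> ?S\<close> by blast
      then have "r \<in> carrier G" using R_H H_carrier by blast
      then have "g \<otimes> s \<otimes> inv g = (g \<otimes> k) \<otimes> r \<otimes> inv (g \<otimes> k)"
        using k \<open>g \<in> carrier G\<close> by (simp add: inv_mult_group m_assoc)
      then show ?thesis using k \<open>g \<in> carrier G\<close> by blast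
    qed
    have "f s \<in> ?S" if "s \<in> ?S" for s
    proof -
      obtain g r where g: "g \<in> carrier G" "r \<in> ?R" "s = g \<otimes> r \<otimes> inv g" using \<open>s \<in> ?S\<close> by blast
      have rc: "r \<in> carrier G" using g R_H H_carrier by blast
      have "inv t \<notin> H" using t subgroup_H by (metis inv_inv subgroup.m_inv_closed)
      then obtain j :: nat where j: "g \<otimes> inv t [^] j \<in> H"
        using cyclic_quotient[of "inv t" g] t(1) g(1) by auto
      define h where "h = g \<otimes> inv t [^] j"
      have h: "h \<in> H" "h \<in> carrier G" using j H_carrier by (auto simp: h_def)
      have gh: "g = h \<otimes> t [^] j"
        using g(1) t(1) by (simp add: h_def m_assoc nat_pow_inv)
      let ?r = "t [^] j \<otimes> r \<otimes> inv (t [^] j)"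
      have r: "?r \<in> ?R" using conj_pow_R g(2) by blast
      then have rH: "?r \<in> H" using R_H by blast
      have "s = h \<otimes> ?r \<otimes> inv h"
        using h t(1) rc by (simp add: g(3) gh m_assoc inv_mult_group)
      then have "f s = f (h \<otimes> ?r \<otimes> inv h)" by simp
      also have "\<dots> = f h \<otimes> f ?r \<otimes> inv (f h)" using h(1) rH by (simp add: f_mult f_inv m_closed)
      finally show ?thesis using f_closed[OF h(1)] f_R[OF r] by blast
    qed
    then show "f ` ?S \<subseteq> generate G ?S" by (intro image_subsetI generate.incl)
  qed
  moreover have "(f ^^ m) x \<in> ?S"
  proof -
    have "(f ^^ m) x \<in> ?R" using x by blast
    moreover from this have "(f ^^ m) x = \<one> \<otimes> (f ^^ m) x \<otimes> inv \<one>" using R_H H_carrier by auto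
    ultimately show ?thesis using one_closed by blast
  qed
  ultimately show ?thesis by blast
qed

text \<open>
  Otherwise torsion yields \<open>x \<notin> P\<close> with \<open>x [^] p \<in> P\<close>, which can be moved into the domain of
  \<open>f ^^ Suc m\<close> for the \<open>m\<close> of \<open>stable_level\<close>.  As \<open>x [^] q\<close> then lies in the stable term, which
  \<open>f ^^ m\<close> kills, \<open>(f ^^ m) x \<in> P\<close>, against \<open>iter_reflects_P\<close>.
\<close>
lemma carrier_eq_P:
  fixes p a n :: nat
  assumes q: "q = p ^ n"
    and centralises: "\<And>g x. \<lbrakk>g \<in> carrier G; x \<in> P\<rbrakk> \<Longrightarrow> g [^] (p ^ a) \<otimes> x = x \<otimes> g [^] (p ^ a)"
    and in_H: "\<And>g. g \<in> carrier G \<Longrightarrow> g [^] (p ^ a) \<in> H"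
  shows "carrier G = P"
proof (rule ccontr)
  assume "carrier G \<noteq> P"
  then obtain g where g: "g \<in> carrier G" "g \<notin> P" using P_carrier by blast
  have "g [^] (p ^ (a + n)) = \<one>"
    using torsion[OF centralises in_H g(1)] by (simp add: q power_add)
  then have "g [^] (p ^ (a + n)) \<in> P" using P_subgroup subgroup.one_closed by metis
  moreover have "g [^] (p ^ 0) \<notin> P" using g by simp
  ultimately obtain k where k: "g [^] (p ^ Suc k) \<in> P" "g [^] (p ^ k) \<notin> P"
    using ex_least_nat_less[of "\<lambda>k. g [^] (p ^ k) \<in> P"] by blast
  define y where "y = g [^] (p ^ k)"
  have y: "y \<in> carrier G" "y \<notin> P" "y [^] p \<in> P"
    using g(1) k by (auto simp: y_def nat_pow_pow mult.commute)
  have "n \<noteq> 0"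
  proof
    assume "n = 0"
    then have "P = {\<one>}" by (auto simp: P_def q)
    then show False using P_nontrivial by blast
  qed
  then have p_dvd_q: "p dvd q" by (simp add: q)
  obtain m where m: "P \<inter> iterate_dom (Suc (Suc m)) = P \<inter> iterate_dom (Suc m)"
    "\<And>i. i \<le> m \<Longrightarrow> P \<inter> iterate_dom (Suc i) \<noteq> P \<inter> iterate_dom i"
    by (rule stable_level) blast
  obtain u where u: "u \<in> P" "y \<otimes> u \<in> iterate_dom (Suc m)"
    using adjust_into_iterate_dom[OF m(2) _ y(1)] by blast
  define x where "x = y \<otimes> u"
  have x: "x \<in> iterate_dom (Suc m)" "x \<in> iterate_dom m" "x \<in> carrier G"
    using u(2) iterate_dom_Suc iterate_dom_carrier by (auto simp: x_def simp del: iterate_dom.simps)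
  have "x \<notin> P"
  proof
    assume "x \<in> P"
    then have "x \<otimes> inv u \<in> P" using u(1) P_subgroup by (simp add: subgroup.m_closed subgroup.m_inv_closed)
    then show False using y u(1) P_carrier by (simp add: x_def m_assoc)
  qed
  obtain v where "v \<in> P" "x [^] p = y [^] p \<otimes> v"
    using normal_mult_nat_pow[OF P_normal y(1) u(1)] by (auto simp: x_def)
  then have "x [^] p \<in> P" using y(3) P_subgroup by (simp add: subgroup.m_closed)
  moreover obtain c where "q = p * c" using p_dvd_q by blast
  ultimately have "x [^] q \<in> P"
    using x(3) subgroup_nat_pow_closed[OF P_subgroup] by (simp flip: nat_pow_pow)
  moreover have "x [^] q \<in> iterate_dom (Suc m)"
    using x(1) by (intro subgroup_nat_pow_closed iterate_dom_subgroup)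
  ultimately have "(f ^^ m) (x [^] q) = \<one>" 
    using iter_kills_stable_level[OF m(1) m(2)] by blast
  then have "(f ^^ m) x \<in> P"
    using x(2) iter_closed by (simp add: P_def iter_nat_pow)
  then show False using iter_reflects_P x(2) \<open>x \<notin> P\<close> by blast
qed

end

section \<open>The virtual endomorphism of a self-similar group\<close>

text \<open>
  \<open>H\<close> is the stabilizer of \<open>[0]\<close> and \<open>f\<close> takes the state at \<open>[0]\<close>.  By the roots, \<open>p\<close>-th powers act
  trivially on the \<open>p\<close> letters.  So each element acts on the letters trivially or as a \<open>p\<close>-cycle,
  which shows that \<open>H\<close> is the kernel of this action and that the quotient is cyclic of order \<open>p\<close>.
\<close>
lemma (in group) self_similar_imp_virtual_endomorphism:
  assumes p: "Factorial_Ring.prime p" and ss: "self_similar p G"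
    and roots: "\<And>b g. \<lbrakk>coprime b p; g \<in> carrier G\<rbrakk> \<Longrightarrow> \<exists>y\<in>carrier G. y [^] (b::nat) = g"
  obtains H f where "simple_virtual_endomorphism H G f" "\<And>g. g \<in> carrier G \<Longrightarrow> g [^] p \<in> H"
proof -
  let ?V = "tree_vertices p"
  obtain \<rho> where faithful: "faithful_action G ?V \<rho>"
    and auto: "\<rho> ` carrier G \<subseteq> tree_automorphisms p"
    and state: "\<And>g u. g \<in> carrier G \<Longrightarrow> u \<in> ?V \<Longrightarrow> tree_state p (\<rho> g) u \<in> \<rho> ` carrier G"
    and trans: "\<And>x y. x < p \<Longrightarrow> y < p \<Longrightarrow> \<exists>g\<in>carrier G. \<rho> g [x] = [y]"
    using ss unfolding self_similar_def by blast
  interpret \<rho>: faithful_action G ?V \<rho> by (rule faithful)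
  interpret V: set_action G \<rho> ?V
  proof unfold_locales
    show "\<rho> g w \<in> ?V" if "g \<in> carrier G" "w \<in> ?V" for g w
      using \<rho>.element_image[OF that refl] .
    show "\<rho> \<one> w = w" if "w \<in> ?V" for w
      unfolding \<rho>.id_eq_one[symmetric] using that by simp
    show "\<rho> (g \<otimes> h) w = \<rho> g (\<rho> h w)" if "g \<in> carrier G" "h \<in> carrier G" "w \<in> ?V" for g h w
      using \<rho>.composition_rule[OF that(3,1,2)] .
  qed
  have p0: "0 < p" using p prime_gt_0_nat by blast
  have Cons_V: "x # w \<in> ?V \<longleftrightarrow> x < p \<and> w \<in> ?V" for x w by (simp add: tree_vertices_def)
  have Nil_V: "[] \<in> ?V" by (simp add: tree_vertices_def)
  have eqI: "g = h"
    if "g \<in> carrier G" "h \<in> carrier G" "\<And>w. w \<in> ?V \<Longrightarrow> \<rho> g w = \<rho> h w" for g h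
  proof -
    have "\<rho> g \<in> extensional ?V" "\<rho> h \<in> extensional ?V"
      using that \<rho>.bij_prop0 by (auto simp: Bij_def)
    then have "\<rho> g = \<rho> h" using that(3) by (rule extensionalityI)
    then show ?thesis using \<rho>.faithful that by (auto dest: inj_onD)
  qed
  have letter: "\<exists>y<p. \<rho> g [x] = [y]" if "g \<in> carrier G" "x < p" for g x
  proof -
    have "length (\<rho> g [x]) = 1" "\<rho> g [x] \<in> ?V"
      using that auto tree_automorphism_length[of "\<rho> g" p "[x]"] V.act_closed Cons_V Nil_V by auto
    then show ?thesis using Cons_V by (metis length_0_conv length_Suc_conv One_nat_def)
  qed
  define \<tau> where "\<tau> g u = inv_into (carrier G) \<rho> (tree_state p (\<rho> g) u)" for g u
  have \<tau>_carrier: "\<tau> g u \<in> carrier G" and \<tau>: "\<rho> g (u @ w) = \<rho> g u @ \<rho> (\<tau> g u) w"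
    if "g \<in> carrier G" "u \<in> ?V" "w \<in> ?V" for g u w
    using state[OF that(1,2)] that auto
    by (auto simp: \<tau>_def inv_into_into f_inv_into_f intro!: tree_state_append)

  define \<alpha> where "\<alpha> g x = hd (\<rho> g [x])" for g x
  have \<rho>_letter: "\<rho> g [x] = [\<alpha> g x]" if "g \<in> carrier G" "x < p" for g x
    using letter[OF that] by (auto simp: \<alpha>_def)
  have \<alpha>: "set_action G \<alpha> {..<p}"
  proof
    show "\<alpha> g x \<in> {..<p}" if "g \<in> carrier G" "x \<in> {..<p}" for g x
      using letter[of g x] that by (auto simp: \<alpha>_def)
    then have lt: "\<alpha> g x < p" if "g \<in> carrier G" "x < p" for g x using that by blast
    show "\<alpha> \<one> x = x" if "x \<in> {..<p}" for x
      using that V.act_one Cons_V Nil_V by (simp add: \<alpha>_def)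
    show "\<alpha> (g \<otimes> h) x = \<alpha> g (\<alpha> h x)" if "g \<in> carrier G" "h \<in> carrier G" "x \<in> {..<p}" for g h x
      using that V.act_mult[of g h "[x]"] Cons_V Nil_V \<rho>_letter lt by simp
  qed
  then interpret \<alpha>: set_action G \<alpha> "{..<p}" .
  have pow_p: "\<alpha> (g [^] p) x = x" if "g \<in> carrier G" "x < p" for g x
  proof (rule \<alpha>.pow_fixes)
    show "\<exists>y\<in>carrier G. y [^] b = g" if "coprime b p" for b :: nat
      using roots \<open>g \<in> carrier G\<close> that by blast
    show "fact (card {..<p}) = p * fact (p - 1)" using p0 by (simp add: fact_reduce)
    show "coprime (fact (p - 1)) p"
      using p p0 by (metis coprime_commute diff_less not_le prime_dvd_fact_iff prime_imp_coprime_nat zero_less_one)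
  qed (use that in auto)
  have cycle: "\<exists>i::nat. \<alpha> (g [^] i) x = y" if "g \<in> carrier G" "x < p" "y < p" "\<alpha> g x \<noteq> x" for g x y
    using \<alpha>.prime_cycle[of g x y] p pow_p that by auto

  define H where "H = {g \<in> carrier G. \<alpha> g 0 = 0}"
  define f where "f g = \<tau> g [0]" for g
  have H_fixes: "\<alpha> h x = x" if "h \<in> H" "x < p" for h x
  proof (rule ccontr)
    have h: "h \<in> carrier G" "\<alpha> h 0 = 0" using that by (auto simp: H_def)
    assume "\<alpha> h x \<noteq> x"
    then obtain i :: nat where "\<alpha> (h [^] i) x = 0" using cycle[OF h(1) \<open>x < p\<close> p0] by blast
    moreover have "\<alpha> (h [^] i) 0 = 0" using \<alpha>.fixed_nat_pow h p0 by simp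
    ultimately have "x = 0" using \<alpha>.act_inj[of "h [^] i" x 0] h(1) that(2) p0 by simp
    then show False using h \<open>\<alpha> h x \<noteq> x\<close> by simp
  qed
  have H_eq: "H = {g \<in> carrier G. \<forall>x<p. \<alpha> g x = x}" using H_fixes p0 by (auto simp: H_def)
  have H_carrier: "h \<in> carrier G" if "h \<in> H" for h using that by (simp add: H_def)
  have sub_H: "subgroup H G"
    unfolding H_def using p0 
    by unfold_locales (auto simp: \<alpha>.act_mult \<alpha>.act_one, metis \<alpha>.act_inv(1) lessThan_iff)
  have normal_H: "H \<lhd> G"
  proof -
    have "g \<otimes> h \<otimes> inv g \<in> H" if "g \<in> carrier G" "h \<in> H" for g h
    proof -
      have "h \<in> carrier G" using that H_carrier by blast
      moreover have "\<alpha> (inv g) 0 < p" using \<alpha>.act_closed[of "inv g" 0] that p0 by simp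
      ultimately have "\<alpha> (g \<otimes> h \<otimes> inv g) 0 = 0"
        using that p0 H_fixes by (simp add: \<alpha>.act_mult \<alpha>.act_inv)
      then show ?thesis using \<open>h \<in> carrier G\<close> that by (simp add: H_def)
    qed
    then show ?thesis using sub_H by (simp add: normal_inv_iff)
  qed
  have V0: "[0] \<in> ?V" using p0 Cons_V Nil_V by simp
  have f_carrier: "f h \<in> carrier G" if "h \<in> H" for h
    using \<tau>_carrier[OF H_carrier[OF that] V0 Nil_V] by (simp add: f_def)
  have f: "\<rho> h (0 # w) = 0 # \<rho> (f h) w" if "h \<in> H" "w \<in> ?V" for h w
    using \<tau>[OF H_carrier[OF that(1)] V0 that(2)] \<rho>_letter[OF H_carrier[OF that(1)] p0] that(1)
    by (simp add: f_def H_def)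
  have "simple_virtual_endomorphism H G f"
  proof (intro simple_virtual_endomorphism.intro simple_virtual_endomorphism_axioms.intro)
    show "H \<lhd> G" by (rule normal_H)
    show "f x \<in> carrier G" if "x \<in> H" for x by (rule f_carrier[OF that])
    show "f (x \<otimes> y) = f x \<otimes> f y" if "x \<in> H" "y \<in> H" for x y
    proof (rule eqI)
      have xy: "x \<otimes> y \<in> H" using that sub_H by (simp add: subgroup.m_closed)
      show "f (x \<otimes> y) \<in> carrier G" "f x \<otimes> f y \<in> carrier G" using xy that f_carrier by auto
      fix w assume w: "w \<in> ?V"
      have "0 # \<rho> (f (x \<otimes> y)) w = \<rho> (x \<otimes> y) (0 # w)" using f[OF xy w] by simp
      also have "\<dots> = \<rho> x (\<rho> y (0 # w))"
        using that w p0 H_carrier Cons_V by (intro V.act_mult) auto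
      also have "\<dots> = 0 # \<rho> (f x) (\<rho> (f y) w)"
        using f that w V.act_closed f_carrier by simp
      also have "\<dots> = 0 # \<rho> (f x \<otimes> f y) w"
        using that w f_carrier by (simp add: V.act_mult)
      finally show "\<rho> (f (x \<otimes> y)) w = \<rho> (f x \<otimes> f y) w" by simp
    qed
    show "\<exists>j::nat. g \<otimes> u [^] j \<in> H" if "u \<in> carrier G" "u \<notin> H" "g \<in> carrier G" for u g
    proof -
      have "\<alpha> u 0 \<noteq> 0" using that by (simp add: H_def)
      moreover have "\<alpha> (inv g) 0 < p" using \<alpha>.act_closed[of "inv g" 0] that p0 by simp
      ultimately obtain j :: nat where "\<alpha> (u [^] j) 0 = \<alpha> (inv g) 0"
        using cycle[OF \<open>u \<in> carrier G\<close> p0] by blast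
      then have "\<alpha> (g \<otimes> u [^] j) 0 = 0" using that p0 by (simp add: \<alpha>.act_mult \<alpha>.act_inv)
      then show ?thesis using that by (auto simp: H_def)
    qed
    \<comment> \<open>An element \<open>k\<close> of \<open>K\<close> fixes all words, by induction on their length: with \<open>g\<close> moving \<open>[0]\<close> to
      \<open>[x]\<close>, \<open>k\<close> acts below \<open>[x]\<close> as a conjugate of \<open>f (inv g \<otimes> k \<otimes> g)\<close>, which is in \<open>K\<close>.\<close>
    show "K = {\<one>}" if K: "K \<lhd> G" "K \<subseteq> H" "f ` K \<subseteq> K" for K
    proof -
      have fixed: "\<rho> k w = w" if "k \<in> K" "w \<in> ?V" for k w
        using that
      proof (induction w arbitrary: k)
        case Nil
        then have "\<rho> k \<in> tree_automorphisms p" using auto K(2) H_carrier by blast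
        then show ?case by (simp add: tree_automorphisms_def)
      next
        case (Cons x w)
        have x: "x < p" and w: "w \<in> ?V" using Cons.prems(2) Cons_V by auto
        have kc: "k \<in> carrier G" using Cons.prems(1) K(2) H_carrier by blast
        obtain g where g: "g \<in> carrier G" "\<rho> g [0] = [x]" using trans[OF p0 x] by blast
        define k' where "k' = inv g \<otimes> k \<otimes> g"
        have k': "k' \<in> K" using normal.inv_op_closed1[OF K(1) g(1) Cons.prems(1)] by (simp add: k'_def)
        then have k'H: "k' \<in> H" and k'c: "k' \<in> carrier G" using K(2) H_carrier by auto
        have fk': "f k' \<in> K" "f k' \<in> carrier G" using K(3) k' k'H f_carrier by auto
        define a where "a = \<tau> g [0]"
        have a: "a \<in> carrier G" using \<tau>_carrier[OF g(1) V0 Nil_V] by (simp add: a_def)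
        have ga: "\<rho> g (0 # v) = x # \<rho> a v" if "v \<in> ?V" for v
          using \<tau>[OF g(1) V0 that] g(2) by (simp add: a_def)
        define v where "v = \<rho> (inv a) w"
        have v: "v \<in> ?V" "\<rho> a v = w" using V.act_closed V.act_inv a w by (auto simp: v_def)
        have gk: "k \<otimes> g = g \<otimes> k'" using g(1) kc by (simp add: k'_def m_assoc mult_inv_cancel_left)
        have "\<rho> k (x # w) = \<rho> k (\<rho> g (0 # v))" using ga[OF v(1)] v(2) by simp
        also have "\<dots> = \<rho> g (\<rho> k' (0 # v))"
          using V.act_mult[OF kc g(1), of "0 # v"] V.act_mult[OF g(1) k'c, of "0 # v"] gk v(1) p0 Cons_V
          by simp
        also have "\<dots> = x # \<rho> a (\<rho> (f k') v)"
          using f[OF k'H v(1)] ga V.act_closed[OF fk'(2) v(1)] by simp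
        also have "\<rho> a (\<rho> (f k') v) = \<rho> (a \<otimes> f k' \<otimes> inv a) w"
          using a fk'(2) w v(1) by (simp add: v_def V.act_mult)
        also have "\<dots> = w"
          using normal.inv_op_closed2[OF K(1) a fk'(1)] w by (rule Cons.IH)
        finally show ?case .
      qed
      have "k = \<one>" if "k \<in> K" for k
        using that fixed K(2) H_carrier by (intro eqI) (auto simp: V.act_one)
      moreover have "\<one> \<in> K" using normal_imp_subgroup[OF K(1)] by (rule subgroup.one_closed)
      ultimately show ?thesis by blast
    qed
  qed
  moreover have "g [^] p \<in> H" if "g \<in> carrier G" for g using pow_p that p0 by (simp add: H_def)
  ultimately show ?thesis using that by blast
qed

section \<open>Self-similar pro-p groups of finite rank with torsion\<close>

lemma pro_p_groupI:
  assumes "Factorial_Ring.prime p" "pro_p_group p G T"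
  shows "pro_p G T p"
proof -
  have "profinite_group G T" using assms(2) by (simp add: pro_p_group_def)
  then have top: "topological_grp G T" "compact_space T" "Hausdorff_space T"
    and base: "\<forall>U. openin T U \<and> \<one>\<^bsub>G\<^esub> \<in> U \<longrightarrow> (\<exists>H. subgroup H G \<and> openin T H \<and> H \<subseteq> U)"
    by (simp_all add: profinite_group_def)
  then show ?thesis
    using assms by (auto simp: pro_p_def pro_p_axioms_def pro_p_group_def)
qed

text \<open>A finite Hausdorff group is discrete, so its trivial subgroup is open.\<close>
lemma (in pro_p) order_prime_power:
  assumes fin: "finite (carrier G)"
  shows "\<exists>k. order G = p ^ k"
proof -
  have "closedin T (topspace T - {\<one>})"
    using fin Hausdorff topspace_eq
    by (metis Hausdorff_imp_t1_space t1_space_closedin_finite finite_Diff Diff_subset)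
  then have "openin T (topspace T - (topspace T - {\<one>}))" by blast
  moreover have "topspace T - (topspace T - {\<one>}) = {\<one>}" using topspace_eq by auto
  ultimately obtain k where "card (rcosets {\<one>}) = p ^ k"
    using index[OF one_is_normal] by auto
  then show ?thesis using lagrange[OF triv_subgroup] by (intro exI[of _ k]) simp
qed

theorem theorem1p1:
  fixes p n :: nat and G :: "('a, 'b) monoid_scheme" and T :: "'a topology"
  assumes "Factorial_Ring.prime p"
    and "pro_p_group p G T"
    and "finite_rank G T"
    and "subgroup {g \<in> carrier G. g [^]\<^bsub>G\<^esub> (p ^ n) = \<one>\<^bsub>G\<^esub>} G"
    and "{g \<in> carrier G. g [^]\<^bsub>G\<^esub> (p ^ n) = \<one>\<^bsub>G\<^esub>} \<noteq> {\<one>\<^bsub>G\<^esub>}"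
    and "self_similar p G"
  shows "finite_p_group p G \<and> group_exponent G \<le> p ^ n"
proof -
  interpret pro_p G T p using assms(1,2) by (rule pro_p_groupI)
  define P where "P = {g \<in> carrier G. g [^]\<^bsub>G\<^esub> (p ^ n) = \<one>\<^bsub>G\<^esub>}"
  have q: "0 < p ^ n" using assms(1) prime_gt_0_nat by simp
  have Psub: "subgroup P G" using assms(4) by (simp add: P_def)
  have fin_P: "finite P" using finite_bounded_exponent_subgroup[OF P_def Psub q assms(3)] .
  obtain H f where simple: "simple_virtual_endomorphism H G f"
    and pow_H: "\<And>g. g \<in> carrier G \<Longrightarrow> g [^]\<^bsub>G\<^esub> p \<in> H"
    using self_similar_imp_virtual_endomorphism[OF assms(1,6) root_exists] by blast
  interpret torsion_simple_virtual_endomorphism H G f "p ^ n" P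
  proof (intro torsion_simple_virtual_endomorphism.intro simple
      torsion_simple_virtual_endomorphism_axioms.intro)
    show "P \<noteq> {\<one>\<^bsub>G\<^esub>}" using assms(5) by (simp add: P_def)
  qed (fact P_def Psub fin_P)+
  interpret conj: set_action G "\<lambda>g x. g \<otimes>\<^bsub>G\<^esub> x \<otimes>\<^bsub>G\<^esub> inv\<^bsub>G\<^esub> g" P
    by unfold_locales (rule P_conj, simp_all add: P_carrier m_assoc inv_mult_group)
  \<comment> \<open>\<open>G\<close> acts on the finite set \<open>P\<close> by conjugation, hence through elements of p-power order.\<close>
  obtain a b where ab: "\<not> p dvd b" "fact (card P) = b * p ^ a"
    using prime_power_canonical[OF assms(1), of "fact (card P)"] by auto
  have "coprime b p" using ab(1) assms(1) by (metis coprime_commute prime_imp_coprime_nat)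
  have centralises: "g [^]\<^bsub>G\<^esub> (p ^ a) \<otimes>\<^bsub>G\<^esub> x = x \<otimes>\<^bsub>G\<^esub> g [^]\<^bsub>G\<^esub> (p ^ a)"
    if g: "g \<in> carrier G" and x: "x \<in> P" for g x
  proof -
    have c: "g [^]\<^bsub>G\<^esub> (p ^ a) \<in> carrier G" "x \<in> carrier G" using g x P_carrier by auto
    have "g [^]\<^bsub>G\<^esub> (p ^ a) \<otimes>\<^bsub>G\<^esub> x \<otimes>\<^bsub>G\<^esub> inv\<^bsub>G\<^esub> (g [^]\<^bsub>G\<^esub> (p ^ a)) = x"
    proof (rule conj.pow_fixes[OF root_exists[OF _ g] fin_P x])
      show "fact (card P) = p ^ a * b" using ab(2) by (simp add: mult.commute)
      show "coprime b p" by fact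
    qed
    then have "g [^]\<^bsub>G\<^esub> (p ^ a) \<otimes>\<^bsub>G\<^esub> x \<otimes>\<^bsub>G\<^esub> inv\<^bsub>G\<^esub> (g [^]\<^bsub>G\<^esub> (p ^ a)) \<otimes>\<^bsub>G\<^esub> g [^]\<^bsub>G\<^esub> (p ^ a)
        = x \<otimes>\<^bsub>G\<^esub> g [^]\<^bsub>G\<^esub> (p ^ a)" by simp
    then show ?thesis using c by (simp add: m_assoc)
  qed
  \<comment> \<open>One more factor \<open>p\<close> in the exponent brings the powers into \<open>H\<close> as well.\<close>
  have pow_Suc: "g [^]\<^bsub>G\<^esub> (p ^ Suc a) = (g [^]\<^bsub>G\<^esub> p) [^]\<^bsub>G\<^esub> (p ^ a)" if "g \<in> carrier G" for g
    using that by (simp add: nat_pow_pow)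
  have "carrier G = P"
  proof (rule carrier_eq_P[OF refl])
    show "g [^]\<^bsub>G\<^esub> (p ^ Suc a) \<otimes>\<^bsub>G\<^esub> x = x \<otimes>\<^bsub>G\<^esub> g [^]\<^bsub>G\<^esub> (p ^ Suc a)" if "g \<in> carrier G" "x \<in> P" for g x
      using centralises[of "g [^]\<^bsub>G\<^esub> p" x] that by (simp only: pow_Suc nat_pow_closed)
    show "g [^]\<^bsub>G\<^esub> (p ^ Suc a) \<in> H" if "g \<in> carrier G" for g
      using subgroup_nat_pow_closed[OF subgroup_H pow_H[OF that]] that by (simp only: pow_Suc)
  qed
  then have fin: "finite (carrier G)" and exp: "\<forall>g\<in>carrier G. g [^]\<^bsub>G\<^esub> (p ^ n) = \<one>\<^bsub>G\<^esub>"
    using fin_P by (auto simp: P_def)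
  have "finite_p_group p G"
    using order_prime_power[OF fin] fin is_group by (simp add: finite_p_group_def)
  moreover have "group_exponent G \<le> p ^ n"
    unfolding group_exponent_def using q exp by (intro Least_le) simp
  ultimately show ?thesis ..
qed

end
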